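(* There exists a universal constant $C>0$ such that for any $\alpha\in(0,1)$ and $n\ge C\log(1/\alpha)$, the interval $$\widehat{\mathrm{CI}}=\Big[\max_{1.6\le t\le T}\Big(F_n^{-1}\big(2(1-\Phi(t))\big)+t-\frac{2}{t}\Big),\ \min_{1.6\le t\le T}\Big(F_n^{-1}\big(1-2(1-\Phi(t))\big)-t+\frac{2}{t}\Big)\Big],\qquad T=\Phi^{-1}\Big(1-\sqrt{\tfrac{\log(2/\alpha)}{2n}}\Big),$$ satisfies $$\text{(coverage)}\quad\inf_{\epsilon\in[0,0.05],\,\theta,\,Q}P_{\epsilon,\theta,Q}\big(\theta\in\widehat{\mathrm{CI}}\big)\ge 1-\alpha,$$ $$\text{(length)}\quad\inf_{\epsilon\in[0,0.05],\,\theta,\,Q}P_{\epsilon,\theta,Q}\left(|\widehat{\mathrm{CI}}|\le C'\Big(\frac{1}{\sqrt{\log n}}+\frac{1}{\sqrt{\log(1/\epsilon)}}\Big)\right)\ge 1-\alpha,$$ where $C'>0$ is some constant depending only on $\alpha$.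
   Context: For $\epsilon\in[0,1]$, $\theta\in\mathbb{R}$ and an arbitrary probability distribution $Q$ on $\mathbb{R}$, let $P_{\epsilon,\theta,Q}=(1-\epsilon)N(\theta,1)+\epsilon Q$. The data are $X_1,\ldots,X_n\overset{iid}{\sim}P_{\epsilon,\theta,Q}$, and $P_{\epsilon,\theta,Q}(\cdot)$ of an event about the data is its probability under this sampling. Infima over $\theta,Q$ are over all $\theta\in\mathbb{R}$ and all probability distributions $Q$ on $\mathbb{R}$. $\Phi$ is the standard Gaussian CDF. $F_n(t)=\frac1n\sum_{i=1}^n\mathbf{1}\{X_i\le t\}$ is the empirical CDF, and for any CDF $F$ the quantile function is $F^{-1}(q)=\inf\{t\in\mathbb{R}:F(t)\ge q\}$; thus $F_n^{-1}(q)=X_{(\lceil nq\rceil)}$ in terms of the order statistics $X_{(1)}\le\cdots\le X_{(n)}$. An interval $[L,U]$ is the empty set if $U<L$; $|\cdot|$ is length (Lebesgue measure). The term $1/\sqrt{\log(1/\epsilon)}$ is read as $0$ when $\epsilon=0$.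
   Formalization: For α>1/2 the length bound is claimed only if T≥1.6: otherwise (e.g. n=2, α near 1) max and min range over the empty set and length or coverage fails. Max/min are read as sup/inf (the max need not be attained); over an empty range the interval is the whole line. *)

theory Defs
  imports "HOL-Probability.Probability"
begin

definition contaminated_normal :: "real \<Rightarrow> real \<Rightarrow> real measure \<Rightarrow> real measure" where
  "contaminated_normal \<epsilon> \<theta> Q =
     measure_of UNIV (sets borel)
       (\<lambda>A. ennreal (1 - \<epsilon>) * emeasure (density lborel (normal_density \<theta> 1)) A
            + ennreal \<epsilon> * emeasure Q A)"

definition sampling :: "nat \<Rightarrow> real \<Rightarrow> real \<Rightarrow> real measure \<Rightarrow> (nat \<Rightarrow> real) measure" where
  "sampling n \<epsilon> \<theta> Q = Pi\<^sub>M {..<n} (\<lambda>_. contaminated_normal \<epsilon> \<theta> Q)"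

definition \<Phi> :: "real \<Rightarrow> real" where
  "\<Phi> = cdf std_normal_distribution"

definition ecdf :: "nat \<Rightarrow> (nat \<Rightarrow> real) \<Rightarrow> real \<Rightarrow> real" where
  "ecdf n X t = (\<Sum>i<n. of_bool (X i \<le> t)) / real n"

text \<open>The infimum is real-valued, so this is the quantile of a distribution function \<open>F\<close>
  wherever that quantile is finite, in particular for \<open>0 < q < 1\<close>.\<close>
definition quantile :: "(real \<Rightarrow> real) \<Rightarrow> real \<Rightarrow> real" where
  "quantile F q = Inf {t. F t \<ge> q}"

definition t_max :: "nat \<Rightarrow> real \<Rightarrow> real" where
  "t_max n \<alpha> = quantile \<Phi> (1 - sqrt (ln (2 / \<alpha>) / (2 * real n)))"

text \<open>The lower maximum need not be attained (the quantile function of the sample jumps down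
  as \<open>t\<close> increases), so both endpoints are extrema in the extended reals.  If
  \<open>t_max n \<alpha> < 1.6\<close>, they are extrema over the empty set and the interval is the whole line.\<close>
definition CI_lower :: "nat \<Rightarrow> real \<Rightarrow> (nat \<Rightarrow> real) \<Rightarrow> ereal" where
  "CI_lower n \<alpha> X =
     (SUP t\<in>{1.6..t_max n \<alpha>}. ereal (quantile (ecdf n X) (2 * (1 - \<Phi> t)) + t - 2 / t))"

definition CI_upper :: "nat \<Rightarrow> real \<Rightarrow> (nat \<Rightarrow> real) \<Rightarrow> ereal" where
  "CI_upper n \<alpha> X =
     (INF t\<in>{1.6..t_max n \<alpha>}. ereal (quantile (ecdf n X) (1 - 2 * (1 - \<Phi> t)) - t + 2 / t))"

definition CI :: "nat \<Rightarrow> real \<Rightarrow> (nat \<Rightarrow> real) \<Rightarrow> real set" where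
  "CI n \<alpha> X = {x. CI_lower n \<alpha> X \<le> ereal x \<and> ereal x \<le> CI_upper n \<alpha> X}"

definition inv_sqrt_log_inv :: "real \<Rightarrow> real" where
  "inv_sqrt_log_inv \<epsilon> = (if \<epsilon> = 0 then 0 else 1 / sqrt (ln (1 / \<epsilon>)))"

lemma sets_contaminated_normal [simp, measurable_cong]:
  "sets (contaminated_normal \<epsilon> \<theta> Q) = sets borel"
  unfolding contaminated_normal_def
  by (metis sets.sigma_sets_eq sets_measure_of space_borel subset_Pow_Union UNIV_I
        sets.space_closed)

lemma space_contaminated_normal [simp]: "space (contaminated_normal \<epsilon> \<theta> Q) = UNIV"
  using sets_eq_imp_space_eq[OF sets_contaminated_normal] by simp

lemma emeasure_contaminated_normal:
  assumes "sets Q = sets borel" and A: "A \<in> sets borel"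
  shows "emeasure (contaminated_normal \<epsilon> \<theta> Q) A =
    ennreal (1 - \<epsilon>) * emeasure (density lborel (normal_density \<theta> 1)) A
    + ennreal \<epsilon> * emeasure Q A"
  unfolding contaminated_normal_def
proof (rule emeasure_measure_of_sigma[OF _ _ _ A])
  let ?N = "density lborel (normal_density \<theta> 1)"
  show "sigma_algebra UNIV (sets (borel :: real measure))"
    using sets.sigma_algebra_axioms[of "borel :: real measure"] by simp
  show "positive (sets borel) (\<lambda>A. ennreal (1 - \<epsilon>) * emeasure ?N A + ennreal \<epsilon> * emeasure Q A)"
    by (simp add: positive_def)
  show "countably_additive (sets borel)
      (\<lambda>A. ennreal (1 - \<epsilon>) * emeasure ?N A + ennreal \<epsilon> * emeasure Q A)"
  proof (rule countably_additiveI)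
    fix B :: "nat \<Rightarrow> real set"
    assume B: "range B \<subseteq> sets borel" "disjoint_family B"
    have "(\<Sum>i. emeasure ?N (B i)) = emeasure ?N (\<Union>i. B i)"
      by (rule suminf_emeasure) (use B in auto)
    moreover have "(\<Sum>i. emeasure Q (B i)) = emeasure Q (\<Union>i. B i)"
      by (rule suminf_emeasure) (use B assms in auto)
    ultimately show "(\<Sum>i. ennreal (1 - \<epsilon>) * emeasure ?N (B i) + ennreal \<epsilon> * emeasure Q (B i)) =
        ennreal (1 - \<epsilon>) * emeasure ?N (\<Union>i. B i) + ennreal \<epsilon> * emeasure Q (\<Union>i. B i)"
      by (subst suminf_add[symmetric]) (auto simp: ennreal_suminf_cmult)
  qed
qed

lemma real_distribution_contaminated_normal:
  assumes "real_distribution Q" and "0 \<le> \<epsilon>" "\<epsilon> \<le> 1"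
  shows "real_distribution (contaminated_normal \<epsilon> \<theta> Q)"
proof -
  interpret Q: real_distribution Q by fact
  interpret N: prob_space "density lborel (normal_density \<theta> 1)"
    by (rule prob_space_normal_density) simp
  have "emeasure (contaminated_normal \<epsilon> \<theta> Q) UNIV = ennreal (1 - \<epsilon>) + ennreal \<epsilon>"
    using N.emeasure_space_1 Q.emeasure_space_1 by (simp add: emeasure_contaminated_normal)
  also have "\<dots> = 1"
    using assms by (simp flip: ennreal_plus)
  finally show ?thesis
    by (auto simp: real_distribution_def real_distribution_axioms_def intro!: prob_spaceI)
qed

end

theory Submission
  imports Defs "HOL-Real_Asymp.Real_Asymp"
begin

text \<open>
  Write \<open>\<delta> = sqrt (ln (2 / \<alpha>) / (2 n)) = 1 - \<Phi>(T)\<close>.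

  Coverage: the substitution \<open>y \<mapsto> y - 2/y\<close> gives \<open>1 - \<Phi>(t - 2/t) \<ge> 5 (1 - \<Phi>(t))\<close> for
  \<open>t \<ge> 1.6\<close>, so the data fall beyond \<open>\<theta> \<mp> (t - 2/t)\<close> with probability at least
  \<open>4.75 (1 - \<Phi>(t))\<close>, whereas \<open>\<theta> \<in> CI\<close> only needs empirical frequencies above \<open>2 (1 - \<Phi>(t))\<close>.
  This slack makes a uniform (Dvoretzky-Kiefer-Wolfowitz) inequality unnecessary: Hoeffding's
  inequality on the geometric grid \<open>1 - \<Phi>(t\<^sub>k) = \<delta> (3/2)^k\<close> with deviations proportional to
  \<open>\<delta> (3/2)^k\<close>, monotonicity in between, and a union bound with terms \<open>(\<alpha>/2)^(k+2)\<close> suffice.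

  Length: it is enough to look at a single \<open>t\<close>.  With \<open>1 - \<Phi>(t) = 2 max \<delta> \<epsilon>\<close>, with probability
  \<open>1 - \<alpha>\<close> both quantiles lie in \<open>\<theta> \<plusminus> t\<close>, whence the length is at most \<open>4/t\<close>, and the Gaussian
  tail turns \<open>1/t\<close> into the stated rate.  If \<open>\<epsilon>\<close> is not small or \<open>n\<close> is bounded, \<open>t = 1.6\<close> gives
  a constant bound; here \<open>1 - \<Phi>(1.6) > 0.05 \<ge> \<epsilon>\<close> is essential.
\<close>

section \<open>The standard normal distribution function\<close>

lemma Phi_diff_eq_integral:
  assumes "a \<le> b"
  shows "\<Phi> b - \<Phi> a = integral {a..b} std_normal_density"
proof -
  interpret real_distribution std_normal_distribution by (rule real_dist_normal_dist)
  have int: "set_integrable lborel {a..b} std_normal_density"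
    unfolding set_integrable_def by (rule integrable_mult_indicator) auto
  \<comment> \<open>The cdf gives a half-open interval, the integral a closed one; the extra
    endpoint is Lebesgue-null.\<close>
  have "emeasure std_normal_distribution {a<..b} = emeasure std_normal_distribution {a..b}"
    by (subst (1 2) emeasure_density)
       (auto intro!: nn_integral_cong_AE eventually_mono[OF AE_lborel_singleton[of a]]
         split: split_indicator)
  then have "measure std_normal_distribution {a<..b} = measure std_normal_distribution {a..b}"
    by (simp add: measure_def)
  also have "\<dots> = (LINT x:{a..b}|lborel. std_normal_density x)"
  proof -
    have "emeasure std_normal_distribution {a..b} =
        (\<integral>\<^sup>+x. ennreal (indicator {a..b} x * std_normal_density x) \<partial>lborel)"
      by (subst emeasure_density) (auto intro!: nn_integral_cong split: split_indicator)
    also have "\<dots> = ennreal (LINT x:{a..b}|lborel. std_normal_density x)"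
      using int unfolding set_lebesgue_integral_def set_integrable_def
      by (subst nn_integral_eq_integral) auto
    finally show ?thesis
      by (simp add: measure_def set_lebesgue_integral_def)
  qed
  also have "\<dots> = integral {a..b} std_normal_density"
    by (rule set_borel_integral_eq_integral(2)[OF int])
  finally show ?thesis
    using assms by (cases "a = b") (auto simp: \<Phi>_def cdf_diff_eq)
qed

lemma Phi_has_real_derivative:
  "(\<Phi> has_real_derivative std_normal_density x) (at x)"
proof -
  \<comment> \<open>The window starts at \<open>x - 1\<close> so that \<open>x\<close> is interior
    and the derivative within the window becomes an unrestricted one.\<close>
  have "((\<lambda>u. integral {x - 1..u} std_normal_density) has_real_derivative std_normal_density x)
      (at x within {x - 1..x + 1})"
    by (rule integral_has_real_derivative)
       (auto simp: normal_density_def intro!: continuous_intros)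
  then have "((\<lambda>u. integral {x - 1..u} std_normal_density) has_real_derivative std_normal_density x)
      (at x)"
    by (simp add: at_within_interior[of x "{x - 1..x + 1}"])
  then have "((\<lambda>u. \<Phi> (x - 1) + integral {x - 1..u} std_normal_density)
      has_real_derivative std_normal_density x) (at x)"
    by (auto intro!: derivative_eq_intros)
  moreover have "\<forall>\<^sub>F u in nhds x. \<Phi> (x - 1) + integral {x - 1..u} std_normal_density = \<Phi> u"
  proof -
    have "\<forall>\<^sub>F u in nhds x. u \<in> {x - 1<..}"
      by (rule eventually_nhds_in_open) auto
    then show ?thesis
      by eventually_elim (simp add: Phi_diff_eq_integral[symmetric])
  qed
  ultimately show ?thesis
    by (subst (asm) DERIV_cong_ev[OF refl _ refl])
qed

lemma isCont_Phi: "isCont \<Phi> x"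
  using DERIV_isCont[OF Phi_has_real_derivative] .

lemma strict_mono_Phi: "strict_mono \<Phi>"
proof (rule strict_monoI)
  show "\<Phi> x < \<Phi> y" if "x < y" for x y
    using that
    by (rule DERIV_pos_imp_increasing) (meson Phi_has_real_derivative normal_density_pos zero_less_one)
qed

lemma Phi_less_iff [simp]: "\<Phi> x < \<Phi> y \<longleftrightarrow> x < y"
  by (rule strict_mono_less[OF strict_mono_Phi])

lemma Phi_le_iff [simp]: "\<Phi> x \<le> \<Phi> y \<longleftrightarrow> x \<le> y"
  by (rule strict_mono_less_eq[OF strict_mono_Phi])

lemma Phi_tendsto_1: "(\<Phi> \<longlongrightarrow> 1) at_top"
  unfolding \<Phi>_def by (rule real_distribution.cdf_lim_at_top_prob[OF real_dist_normal_dist])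

lemma Phi_tendsto_0: "(\<Phi> \<longlongrightarrow> 0) at_bot"
  unfolding \<Phi>_def
  using finite_borel_measure.cdf_lim_at_bot real_distribution.finite_borel_measure_M
    real_dist_normal_dist by blast

lemma Phi_less_1: "\<Phi> x < 1"
proof -
  have "\<Phi> x < \<Phi> (x + 1)" by simp
  also have "\<dots> \<le> 1"
    unfolding \<Phi>_def by (rule real_distribution.cdf_bounded_prob[OF real_dist_normal_dist])
  finally show ?thesis .
qed

lemma ex_Phi_eq:
  assumes "0 < p" "p < 1"
  obtains t where "\<Phi> t = p"
proof -
  obtain a where a: "\<Phi> a < p"
    using order_tendstoD(2)[OF Phi_tendsto_0 assms(1)] eventually_happens'[OF trivial_limit_at_bot_linorder]
    by blast
  obtain b where b: "p < \<Phi> b"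
    using order_tendstoD(1)[OF Phi_tendsto_1 assms(2)] eventually_happens'[OF trivial_limit_at_top_linorder]
    by blast
  have "a \<le> b"
    using a b Phi_less_iff[of a b] by linarith
  then show ?thesis
    using IVT'[of \<Phi> a p b] a b that isCont_Phi by (force intro: continuous_at_imp_continuous_on)
qed

lemma Phi_quantile_Phi:
  assumes "0 < p" "p < 1"
  shows "\<Phi> (quantile \<Phi> p) = p"
proof -
  obtain t where t: "\<Phi> t = p" using ex_Phi_eq[OF assms] .
  then have "{x. \<Phi> x \<ge> p} = {t..}" by auto
  then show ?thesis using t by (simp add: quantile_def)
qed

lemma measure_std_normal_singleton: "measure std_normal_distribution {x} = 0"
  using finite_borel_measure.isCont_cdf real_distribution.finite_borel_measure_M
    real_dist_normal_dist isCont_Phi[of x] unfolding \<Phi>_def by blast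

lemma measure_std_normal_upper:
  "measure std_normal_distribution {x<..} = 1 - \<Phi> x"
  "measure std_normal_distribution {x..} = 1 - \<Phi> x"
proof -
  interpret real_distribution std_normal_distribution by (rule real_dist_normal_dist)
  have "prob {x<..} = prob (space std_normal_distribution - {..x})"
    by (rule arg_cong[where f=prob]) auto
  then show 1: "prob {x<..} = 1 - \<Phi> x"
    by (subst (asm) prob_compl) (auto simp: \<Phi>_def cdf_def)
  have "{x..} = {x} \<union> {x<..}" by auto
  then have "prob {x..} = prob {x} + prob {x<..}"
    by (simp only:) (rule finite_measure_Union, auto)
  then show "prob {x..} = 1 - \<Phi> x"
    using 1 measure_std_normal_singleton by simp
qed

text \<open>The case \<open>c = -1\<close> reflects the line, so that
  \<open>measure_normal_tails\<close> reduces lower tails to upper tails of the standard normal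
  law.\<close>

lemma measure_normal_affine:
  assumes "A \<in> sets borel" "c = 1 \<or> c = -1"
  shows "measure (density lborel (normal_density \<theta> 1)) A =
    measure std_normal_distribution ((\<lambda>x. \<theta> + c * x) -` A)"
proof -
  interpret real_distribution std_normal_distribution by (rule real_dist_normal_dist)
  have "distributed std_normal_distribution lborel (\<lambda>x. x) std_normal_density"
    unfolding distributed_def
    by (auto intro!: measure_eqI simp: emeasure_distr)
  from normal_density_affine[OF this, of c \<theta>] assms(2)
  have "distributed std_normal_distribution lborel (\<lambda>x. \<theta> + c * x) (normal_density \<theta> 1)"
    by auto
  then have "density lborel (normal_density \<theta> 1) =
      distr std_normal_distribution lborel (\<lambda>x. \<theta> + c * x)"
    by (simp add: distributed_def)
  then show ?thesis
    using assms by (simp add: measure_distr)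
qed

lemma measure_normal_tails:
  "measure (density lborel (normal_density \<theta> 1)) {\<theta> + x..} = 1 - \<Phi> x"
  "measure (density lborel (normal_density \<theta> 1)) {\<theta> + x<..} = 1 - \<Phi> x"
  "measure (density lborel (normal_density \<theta> 1)) {..\<theta> - x} = 1 - \<Phi> x"
  "measure (density lborel (normal_density \<theta> 1)) {..<\<theta> - x} = 1 - \<Phi> x"
  by (subst measure_normal_affine[of _ 1] measure_normal_affine[of _ "-1"];
      force simp: vimage_def greaterThan_def[symmetric] atLeast_def[symmetric] measure_std_normal_upper)+

section \<open>Gaussian tail estimates\<close>

lemma nonneg_if_decreasing_to_0:
  fixes G :: "real \<Rightarrow> real"
  assumes "\<And>x. x \<ge> a \<Longrightarrow> (G has_real_derivative G' x) (at x)" "\<And>x. x \<ge> a \<Longrightarrow> G' x \<le> 0"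
    and "(G \<longlongrightarrow> 0) at_top"
  shows "G a \<ge> 0"
proof (rule tendsto_upperbound[OF assms(3)])
  show "\<forall>\<^sub>F x in at_top. G x \<le> G a"
    using eventually_ge_at_top[of a]
  proof eventually_elim
    case (elim x)
    then show ?case
      by (rule DERIV_nonpos_imp_nonincreasing) (use assms(1,2) in blast)
  qed
qed simp

text \<open>Both tails vanish at infinity, so it suffices that their difference decreases. With
  \<open>u = 2 / y\<^sup>2\<close> the two densities differ by the factor
  \<open>exp (2 - u)\<close>, and the sign of the derivative comes down to
  \<open>5 \<le> (1 + u) * exp (2 - u)\<close>.\<close>

lemma normal_tail_ratio:
  assumes "t \<ge> 1.6"
  shows "1 - \<Phi> (t - 2 / t) \<ge> 5 * (1 - \<Phi> t)"
proof -
  define G where "G y = (1 - \<Phi> (y - 2 / y)) - 5 * (1 - \<Phi> y)" for y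
  define G' where
    "G' y = - std_normal_density (y - 2 / y) * (1 + 2 / y\<^sup>2) + 5 * std_normal_density y" for y
  have "G t \<ge> 0"
  proof (rule nonneg_if_decreasing_to_0[where G = G and G' = G' and a = t])
    fix y assume "y \<ge> t"
    then have y: "y \<ge> 1.6" "y > 0" using assms by auto
    show "(G has_real_derivative G' y) (at y)"
      unfolding G_def[abs_def] G'_def using y
      by (auto intro!: derivative_eq_intros DERIV_chain2[of \<Phi>] Phi_has_real_derivative
          simp: power2_eq_square)
    define u where "u = 2 / y\<^sup>2"
    have "y\<^sup>2 \<ge> 1.6\<^sup>2" using y by (intro power_mono) auto
    then have u: "0 \<le> u" "u \<le> 0.8"
      using y by (auto simp: u_def field_simps power2_eq_square)
    \<comment> \<open>The quadratic Taylor polynomial of exp takes the value 5 at 2, hence equality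
      at \<open>u = 0\<close> and a factor \<open>u\<close> in the excess. The bound
      \<open>u \<le> 0.8\<close>, which is where 1.6 enters, makes \<open>2 - 2.5 * u\<close>
      nonnegative.\<close>
    have "5 \<le> (1 + u) * (1 + (2 - u) + (2 - u)\<^sup>2 / 2)"
    proof -
      have "(1 + u) * (1 + (2 - u) + (2 - u)\<^sup>2 / 2) - 5 = u * (2 - 2.5 * u + u\<^sup>2 / 2)"
        by (simp add: power2_eq_square field_simps)
      moreover have "\<dots> \<ge> 0"
        using u by (intro mult_nonneg_nonneg add_nonneg_nonneg) auto
      ultimately show ?thesis by linarith
    qed
    also have "\<dots> \<le> (1 + u) * exp (2 - u)"
      using u by (intro mult_left_mono exp_lower_Taylor_quadratic) auto
    finally have 5: "5 \<le> (1 + u) * exp (2 - u)" .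
    have "(y - 2 / y)\<^sup>2 = y\<^sup>2 - 4 + 2 * u"
      using y by (simp add: u_def power2_eq_square field_simps)
    then have "std_normal_density (y - 2 / y) = std_normal_density y * exp (2 - u)"
      by (simp add: std_normal_density_def exp_add[symmetric] diff_divide_distrib add_divide_distrib)
    then have "G' y = std_normal_density y * (5 - (1 + u) * exp (2 - u))"
      by (simp add: G'_def u_def algebra_simps)
    then show "G' y \<le> 0"
      using 5 by (simp add: mult_nonneg_nonpos)
  next
    have "filterlim (\<lambda>y::real. y - 2 / y) at_top at_top" by real_asymp
    then have "((\<lambda>y. \<Phi> (y - 2 / y)) \<longlongrightarrow> 1) at_top"
      by (rule filterlim_compose[OF Phi_tendsto_1])
    then have "((\<lambda>y. (1 - \<Phi> (y - 2 / y)) - 5 * (1 - \<Phi> y)) \<longlongrightarrow> (1 - 1) - 5 * (1 - 1)) at_top"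
      by (intro tendsto_intros Phi_tendsto_1)
    then show "(G \<longlongrightarrow> 0) at_top" by (simp add: G_def[abs_def])
  qed
  then show ?thesis by (simp add: G_def)
qed

text \<open>A convergent of Laplace's continued fraction for the Mills ratio; the simpler bound
  \<open>x / (x\<^sup>2 + 1)\<close> is too weak to give \<open>1 - \<Phi>(1.6) > 0.05\<close>.\<close>

lemma normal_tail_lower_bound:
  "std_normal_density x * ((x^3 + 5 * x) / (x^4 + 6 * x\<^sup>2 + 3)) \<le> 1 - \<Phi> x"
proof -
  define D where "D y = y^4 + 6 * y\<^sup>2 + 3" for y :: real
  define G where "G y = (1 - \<Phi> y) - std_normal_density y * ((y^3 + 5 * y) / D y)" for y
  have D: "D y > 0" for y
    by (auto simp: D_def intro!: add_nonneg_pos add_nonneg_nonneg)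
  have "G x \<ge> 0"
  proof (rule nonneg_if_decreasing_to_0[where G = G and a = x and G' = "\<lambda>y. - 24 * std_normal_density y / (D y)\<^sup>2"])
    fix y
    have phi: "(std_normal_density has_real_derivative - y * std_normal_density y) (at y)"
      unfolding std_normal_density_def[abs_def]
      by (rule derivative_eq_intros refl | simp)+
    have dD: "(D has_real_derivative 4 * y^3 + 12 * y) (at y)"
      unfolding D_def[abs_def] by (auto intro!: derivative_eq_intros)
    \<comment> \<open>This is minus the numerator of the derivative of \<open>G\<close>, up to the
      density: for this convergent all nonconstant terms cancel.\<close>
    have id: "24 = (D y)\<^sup>2 - y * (y^3 + 5 * y) * D y +
        ((3 * y\<^sup>2 + 5) * D y - (y^3 + 5 * y) * (4 * y^3 + 12 * y))"
      by (simp add: D_def power2_eq_square power3_eq_cube power4_eq_xxxx algebra_simps)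
    have quot: "((\<lambda>y. (y^3 + 5 * y) / D y) has_real_derivative
        ((3 * y\<^sup>2 + 5) * D y - (y^3 + 5 * y) * (4 * y^3 + 12 * y)) / (D y * D y)) (at y)"
      using D[of y] by (auto intro!: derivative_eq_intros dD)
    have "(G has_real_derivative (0 - std_normal_density y) -
        (- y * std_normal_density y * ((y^3 + 5 * y) / D y) +
         ((3 * y\<^sup>2 + 5) * D y - (y^3 + 5 * y) * (4 * y^3 + 12 * y)) / (D y * D y) * std_normal_density y))
        (at y)"
      unfolding G_def[abs_def]
      by (intro DERIV_diff DERIV_const Phi_has_real_derivative DERIV_mult phi quot)
    also have "(0 - std_normal_density y) -
        (- y * std_normal_density y * ((y^3 + 5 * y) / D y) +
         ((3 * y\<^sup>2 + 5) * D y - (y^3 + 5 * y) * (4 * y^3 + 12 * y)) / (D y * D y) * std_normal_density y)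
      = - 24 * std_normal_density y / (D y)\<^sup>2"
      using D[of y] by (simp only: id) (simp add: field_simps power2_eq_square)
    finally show "(G has_real_derivative - 24 * std_normal_density y / (D y)\<^sup>2) (at y)" .
    show "- 24 * std_normal_density y / (D y)\<^sup>2 \<le> 0"
      using D[of y] by simp
  next
    have "((\<lambda>y. std_normal_density y * ((y^3 + 5 * y) / D y)) \<longlongrightarrow> 0) at_top"
      unfolding std_normal_density_def D_def by real_asymp
    then have "((\<lambda>y. (1 - \<Phi> y) - std_normal_density y * ((y^3 + 5 * y) / D y)) \<longlongrightarrow> (1 - 1) - 0) at_top"
      by (intro tendsto_intros Phi_tendsto_1)
    then show "(G \<longlongrightarrow> 0) at_top" by (simp add: G_def[abs_def])
  qed
  then show ?thesis by (simp add: G_def D_def)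
qed

text \<open>The margin of 0.002 over the maximal contamination 0.05 is what
  \<open>length_const\<close> spends on the Gaussian mass beyond \<open>K\<close>.\<close>

lemma normal_tail_1_6: "1 - \<Phi> 1.6 \<ge> 0.052"
proof -
  \<comment> \<open>The exponent of the density at 1.6 is 1.28 = 32 * 0.04; splitting it into 32
    factors makes \<open>1 + x \<le> exp x\<close> sharp enough.\<close>
  have "(0.27::real) \<le> (1 + (- 0.04)) ^ 32" by (simp add: power_numeral_reduce field_simps)
  also have "\<dots> \<le> exp (- 0.04) ^ 32"
    by (intro power_mono exp_ge_add_one_self) auto
  also have "\<dots> = exp (- 1.28)"
    by (simp add: exp_of_nat_mult[symmetric])
  finally have e: "0.27 \<le> exp (- 1.28::real)" .
  have "sqrt (2 * pi) \<le> 2.51"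
    using pi_approx by (intro real_le_lsqrt) (auto simp: power2_eq_square)
  then have "0.27 / 2.51 \<le> exp (- 1.28) / sqrt (2 * pi)"
    using e by (intro frac_le) auto
  then have "0.27 / 2.51 \<le> std_normal_density 1.6"
    by (simp add: std_normal_density_def power2_eq_square)
  then have "0.27 / 2.51 * ((1.6^3 + 5 * 1.6) / (1.6^4 + 6 * 1.6\<^sup>2 + 3)) \<le>
      std_normal_density 1.6 * ((1.6^3 + 5 * 1.6) / (1.6^4 + 6 * 1.6\<^sup>2 + 3))"
    by (intro mult_right_mono) auto
  also have "\<dots> \<le> 1 - \<Phi> 1.6" by (rule normal_tail_lower_bound)
  finally show ?thesis by (simp add: power_numeral_reduce)
qed

text \<open>The mass between \<open>t\<close> and \<open>t + 1\<close> already suffices: it is the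
  density at some \<open>z < t + 1\<close>. The factor \<open>sqrt (2 * pi) \<le> exp 1\<close>
  costs 1 in the exponent, and \<open>t \<ge> 1.6\<close> absorbs everything into
  \<open>2 * t\<^sup>2\<close>. Only the logarithm of the tail matters later, so the crude factor 2
  is harmless.\<close>

lemma normal_tail_ge_exp:
  assumes "t \<ge> 1.6"
  shows "1 - \<Phi> t \<ge> exp (- 2 * t\<^sup>2)"
proof -
  obtain z where z: "t < z" "z < t + 1" "\<Phi> (t + 1) - \<Phi> t = (t + 1 - t) * std_normal_density z"
    using MVT2[of t "t + 1" \<Phi> std_normal_density] Phi_has_real_derivative by auto
  have "sqrt (2 * pi) \<le> exp 1"
  proof -
    have "sqrt (2 * pi) \<le> 2.51"
      using pi_approx by (intro real_le_lsqrt) (auto simp: power2_eq_square)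
    also have "\<dots> \<le> exp 1"
    proof -
      have "(1 + 1/2 + (1/2)\<^sup>2 / 2)\<^sup>2 \<le> (exp (1/2 :: real))\<^sup>2"
        by (intro power_mono exp_lower_Taylor_quadratic) auto
      also have "\<dots> = exp 1" by (simp add: exp_double[symmetric])
      finally show ?thesis by (simp add: power2_eq_square)
    qed
    finally show ?thesis .
  qed
  have "z\<^sup>2 \<le> (t + 1)\<^sup>2" using z assms by (intro power_mono) auto
  moreover have "1.6 * 1.6 \<le> t * t" using assms by (intro mult_mono) auto
  then have "(t + 1)\<^sup>2 / 2 + 1 \<le> 2 * t\<^sup>2"
  proof -
    have "t * 1.6 \<le> t * t" using assms by (intro mult_left_mono) auto
    moreover have "(t + 1)\<^sup>2 = t * t + 2 * t + 1" "t\<^sup>2 = t * t"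
      by (auto simp: power2_eq_square algebra_simps)
    ultimately show ?thesis
      using \<open>1.6 * 1.6 \<le> t * t\<close> assms by linarith
  qed
  ultimately have "exp (- 2 * t\<^sup>2) \<le> exp (- z\<^sup>2 / 2 - 1)" by simp
  also have "\<dots> = exp (- z\<^sup>2 / 2) / exp 1" by (simp add: exp_diff)
  also have "\<dots> \<le> exp (- z\<^sup>2 / 2) / sqrt (2 * pi)"
    using \<open>sqrt (2 * pi) \<le> exp 1\<close> by (intro divide_left_mono) auto
  also have "\<dots> = \<Phi> (t + 1) - \<Phi> t" using z by (simp add: std_normal_density_def)
  also have "\<dots> \<le> 1 - \<Phi> t" using Phi_less_1[of "t + 1"] by simp
  finally show ?thesis .
qed

text \<open>In \<open>normal_tail_ratio\<close> the larger tail is a probability, hence at most 1.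
  This keeps the quantile levels \<open>2 * (1 - \<Phi> t)\<close> away from 1.\<close>

lemma normal_tail_le_fifth:
  assumes "t \<ge> 1.6"
  shows "1 - \<Phi> t \<le> 1 / 5"
proof -
  have "\<Phi> (t - 2 / t) \<ge> 0" by (simp add: \<Phi>_def cdf_def)
  then have "5 * (1 - \<Phi> t) \<le> 1" using order_trans[OF normal_tail_ratio[OF assms]] by simp
  then show ?thesis by simp
qed

text \<open>Converts the tail level \<open>s\<close> at \<open>t\<close> into the rate: the
  exponential bound gives \<open>ln (1 / s) \<le> 2 * t\<^sup>2\<close>, so
  \<open>b \<le> 8 * t\<^sup>2\<close>, relaxed to a square. In the applications \<open>b\<close> is
  \<open>ln n\<close> or \<open>ln (1 / \<epsilon>)\<close>.\<close>

lemma inverse_le_of_normal_tail: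
  assumes t: "t \<ge> 1.6" and s: "1 - \<Phi> t = s" and b: "0 < b" "b \<le> 4 * ln (1 / s)"
  shows "4 / t \<le> 12 / sqrt b"
proof -
  have "exp (- 2 * t\<^sup>2) \<le> s" using normal_tail_ge_exp[OF t] s by simp
  moreover have "s > 0" using s Phi_less_1[of t] by simp
  ultimately have "- 2 * t\<^sup>2 \<le> ln s" by (simp add: ln_ge_iff)
  then have "b \<le> 9 * t\<^sup>2" using b \<open>s > 0\<close> by (simp add: ln_div)
  then have "sqrt b \<le> 3 * t" using t by (intro real_le_lsqrt) (auto simp: power_mult_distrib)
  then show ?thesis using t b by (simp add: field_simps)
qed

section \<open>Empirical frequencies and quantiles\<close>

text \<open>General sets, rather than the half-lines of \<open>ecdf\<close>, cover upper tails and
  complements as well.\<close>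

definition freq :: "nat \<Rightarrow> (nat \<Rightarrow> real) \<Rightarrow> real set \<Rightarrow> real" where
  "freq n X A = (\<Sum>i<n. indicator A (X i)) / real n"

lemma ecdf_eq_freq: "ecdf n X t = freq n X {..t}"
  by (simp add: ecdf_def freq_def indicator_def of_bool_def)

lemma freq_mono: "A \<subseteq> B \<Longrightarrow> freq n X A \<le> freq n X B"
  unfolding freq_def by (intro divide_right_mono sum_mono) (auto split: split_indicator)

lemma freq_compl:
  assumes "n > 0"
  shows "freq n X (- A) = 1 - freq n X A"
proof -
  have "(\<Sum>i<n. indicator (- A) (X i)) = (\<Sum>i<n. 1 - indicator A (X i) :: real)"
    by (intro sum.cong) (auto split: split_indicator)
  then show ?thesis
    using assms by (simp add: freq_def sum_subtractf diff_divide_distrib)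
qed

text \<open>The empirical CDF vanishes below the smallest observation. Together with
  \<open>ecdf_ge_nonempty\<close> this makes the real \<open>Inf\<close> in \<open>quantile\<close>
  a genuine infimum for levels in (0, 1].\<close>

lemma bdd_below_ecdf_ge:
  assumes "q > 0"
  shows "bdd_below {t. ecdf n X t \<ge> q}"
proof (rule bdd_belowI)
  fix t assume "t \<in> {t. ecdf n X t \<ge> q}"
  then have "(\<Sum>i<n. of_bool (X i \<le> t) :: real) \<noteq> 0"
    using assms by (auto simp: ecdf_def)
  then obtain i where "i < n" "X i \<le> t"
    by (metis (mono_tags, lifting) lessThan_iff of_bool_eq(1) sum.neutral)
  then show "Min (X ` {..<n}) \<le> t"
    by (meson Min_le finite_imageI finite_lessThan image_eqI lessThan_iff order_trans)
qed

lemma ecdf_ge_nonempty: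
  assumes "n > 0" "q \<le> 1"
  shows "{t. ecdf n X t \<ge> q} \<noteq> {}"
proof -
  have "ecdf n X (Max (X ` {..<n})) = 1"
    using assms(1) by (simp add: ecdf_def)
  with assms(2) have "q \<le> ecdf n X (Max (X ` {..<n}))" by simp
  then show ?thesis by blast
qed

lemma quantile_ecdf_le:
  "q > 0 \<Longrightarrow> ecdf n X x \<ge> q \<Longrightarrow> quantile (ecdf n X) q \<le> x"
  unfolding quantile_def by (rule cInf_lower) (auto intro: bdd_below_ecdf_ge)

text \<open>Any \<open>y < x\<close> has \<open>{..y}\<close> inside the open half-line, so its
  empirical CDF stays below \<open>q\<close>. The open half-line is the complement of a closed upper
  tail, the form in which coverage uses it.\<close>

lemma quantile_ecdf_ge:
  assumes "n > 0" "q \<le> 1" "freq n X {..<x} < q"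
  shows "x \<le> quantile (ecdf n X) q"
  unfolding quantile_def
proof (rule cInf_greatest[OF ecdf_ge_nonempty])
  fix y assume "y \<in> {t. q \<le> ecdf n X t}"
  then have "freq n X {..<x} < freq n X {..y}" using assms by (simp add: ecdf_eq_freq)
  then show "x \<le> y"
    by (smt (verit) freq_mono atMost_iff lessThan_iff subsetI)
qed fact+

section \<open>Measurability of the endpoints and of the length\<close>

lemma borel_measurable_quantile_ecdf:
  assumes n: "n > 0" and M: "sets M = sets (Pi\<^sub>M {..<n} (\<lambda>_. borel))"
  shows "(\<lambda>X. quantile (ecdf n X) q) \<in> borel_measurable M"
proof -
  note [measurable_cong] = M
  have [measurable]: "(\<lambda>X. ecdf n X t) \<in> borel_measurable M" for t
    unfolding ecdf_def by measurable
  \<comment> \<open>Outside (0, 1] the set under \<open>Inf\<close> is the whole line or empty for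
    every sample, so the quantile is constant, whatever its value.\<close>
  consider "q \<le> 0" | "q > 1" | "0 < q" "q \<le> 1" by linarith
  then show ?thesis
  proof cases
    case 1
    have "{t. ecdf n X t \<ge> q} = UNIV" for X
    proof -
      have "ecdf n X t \<ge> 0" for t by (auto simp: ecdf_def intro!: sum_nonneg divide_nonneg_nonneg)
      then show ?thesis using 1 order_trans by blast
    qed
    then show ?thesis by (simp add: quantile_def)
  next
    case 2
    have "{t. ecdf n X t \<ge> q} = {}" for X
    proof -
      have "ecdf n X t \<le> 1" for t
        using freq_mono[of "{..t}" UNIV n X] n by (simp add: ecdf_eq_freq) (simp add: freq_def)
      then show ?thesis using 2 by (auto simp: not_le intro: le_less_trans)
    qed
    then show ?thesis by (simp add: quantile_def)
  next
    case 3
    \<comment> \<open>Monotonicity of the empirical CDF lets rational thresholds replace real ones,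
      which leaves a countable union.\<close>
    have "{X \<in> space M. quantile (ecdf n X) q < a} =
        {X \<in> space M. \<exists>r::rat. of_rat r < a \<and> ecdf n X (of_rat r) \<ge> q}" for a
    proof -
      have "quantile (ecdf n X) q < a \<longleftrightarrow> (\<exists>t<a. ecdf n X t \<ge> q)" for X
        unfolding quantile_def using 3 n
        by (subst cInf_less_iff[OF ecdf_ge_nonempty bdd_below_ecdf_ge]) auto
      moreover have "(\<exists>t<a. ecdf n X t \<ge> q) \<longleftrightarrow> (\<exists>r::rat. of_rat r < a \<and> ecdf n X (of_rat r) \<ge> q)" for X
      proof
        assume "\<exists>t<a. ecdf n X t \<ge> q"
        then obtain t where t: "t < a" "ecdf n X t \<ge> q" by auto
        obtain r where r: "t < of_rat r" "of_rat r < a"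
          using of_rat_dense[OF t(1)] by auto
        have "ecdf n X t \<le> ecdf n X (of_rat r)"
          unfolding ecdf_eq_freq using r by (intro freq_mono) auto
        then show "\<exists>r::rat. of_rat r < a \<and> ecdf n X (of_rat r) \<ge> q"
          using r t by (meson order_trans)
      qed auto
      ultimately show ?thesis by simp
    qed
    moreover have "{X \<in> space M. \<exists>r::rat. of_rat r < a \<and> ecdf n X (of_rat r) \<ge> q} \<in> sets M" for a
      by measurable
    ultimately show ?thesis
      by (simp add: borel_measurable_iff_less)
  qed
qed

text \<open>\<open>n\<close> times the empirical CDF is an integer count, so comparing it with
  \<open>n q\<close> or with the ceiling of \<open>n q\<close> is the same.\<close>

lemma quantile_ecdf_ceiling:
  assumes "n > 0"
  shows "quantile (ecdf n X) q = quantile (ecdf n X) (of_int \<lceil>real n * q\<rceil> / real n)"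
proof -
  have "ecdf n X t \<ge> q \<longleftrightarrow> ecdf n X t \<ge> of_int \<lceil>real n * q\<rceil> / real n" for t
  proof -
    define m where "m = (\<Sum>i<n. of_bool (X i \<le> t) :: int)"
    have m: "ecdf n X t = of_int m / real n" by (simp add: ecdf_def m_def)
    have "ecdf n X t \<ge> q \<longleftrightarrow> real n * q \<le> of_int m"
      "ecdf n X t \<ge> of_int \<lceil>real n * q\<rceil> / real n \<longleftrightarrow> real_of_int \<lceil>real n * q\<rceil> \<le> of_int m"
      unfolding m using assms by (auto simp: field_simps)
    then show ?thesis by (simp add: ceiling_le_iff)
  qed
  then show ?thesis by (simp add: quantile_def)
qed

text \<open>The supremum over the uncountable set of \<open>t\<close> in the interval's endpoints is measurable because
  the empirical quantile at level \<open>q\<close> depends on \<open>q\<close> only through \<open>\<lceil>n q\<rceil>\<close>.\<close>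

lemma borel_measurable_SUP_int_index:
  fixes f :: "int \<Rightarrow> 'a \<Rightarrow> real"
  assumes [measurable]: "\<And>k. f k \<in> borel_measurable M"
  shows "(\<lambda>x. SUP t\<in>I. ereal (f (j t) x + b t)) \<in> borel_measurable M"
proof -
  \<comment> \<open>Grouping the \<open>t\<close> by \<open>k = j t\<close> leaves only
    deterministic offsets in the inner supremum; the outer one runs over integers and is
    countable.\<close>
  have eq: "(SUP t\<in>I. ereal (f (j t) x + b t)) =
      (SUP k\<in>j ` I. ereal (f k x) + (SUP t\<in>{t\<in>I. j t = k}. ereal (b t)))" for x
  proof -
    have "(SUP t\<in>I. ereal (f (j t) x + b t)) =
        (SUP k\<in>j ` I. SUP t\<in>{t\<in>I. j t = k}. ereal (f k x + b t))"
      by (rule antisym) (auto intro!: SUP_least intro: SUP_upper SUP_upper2)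
    also have "\<dots> = (SUP k\<in>j ` I. SUP t\<in>{t\<in>I. j t = k}. ereal (f k x) + ereal (b t))"
      by simp
    also have "\<dots> = (SUP k\<in>j ` I. ereal (f k x) + (SUP t\<in>{t\<in>I. j t = k}. ereal (b t)))"
      by (intro SUP_cong refl SUP_ereal_add_right) auto
    finally show ?thesis .
  qed
  have "countable (j ` I)" by simp
  then show ?thesis unfolding eq by (rule borel_measurable_SUP) measurable
qed

lemma borel_measurable_CI_lower:
  assumes n: "n > 0" and M: "sets M = sets (Pi\<^sub>M {..<n} (\<lambda>_. borel))"
  shows "CI_lower n \<alpha> \<in> borel_measurable M"
proof -
  let ?f = "\<lambda>k X. quantile (ecdf n X) (of_int k / real n)"
  have "CI_lower n \<alpha> = (\<lambda>X. SUP t\<in>{1.6..t_max n \<alpha>}.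
      ereal (?f \<lceil>real n * (2 * (1 - \<Phi> t))\<rceil> X + (t - 2 / t)))"
    unfolding CI_lower_def[abs_def] quantile_ecdf_ceiling[OF n, symmetric]
    by (simp add: algebra_simps)
  then show ?thesis
    using borel_measurable_SUP_int_index[OF borel_measurable_quantile_ecdf[OF assms]] by simp
qed

lemma borel_measurable_CI_upper:
  assumes n: "n > 0" and M: "sets M = sets (Pi\<^sub>M {..<n} (\<lambda>_. borel))"
  shows "CI_upper n \<alpha> \<in> borel_measurable M"
proof -
  let ?f = "\<lambda>k X. - quantile (ecdf n X) (of_int k / real n)"
  \<comment> \<open>Negation turns the infimum into a supremum, so the same grouping
    applies.\<close>
  have "CI_upper n \<alpha> = (\<lambda>X. - (SUP t\<in>{1.6..t_max n \<alpha>}.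
      ereal (?f \<lceil>real n * (1 - 2 * (1 - \<Phi> t))\<rceil> X + (t - 2 / t))))"
    unfolding CI_upper_def[abs_def] quantile_ecdf_ceiling[OF n, symmetric] ereal_INF_uminus_eq[symmetric]
    by (simp add: algebra_simps)
  moreover have "?f k \<in> borel_measurable M" for k
    using borel_measurable_quantile_ecdf[OF assms] by measurable
  ultimately show ?thesis
    using borel_measurable_uminus_ereal[OF borel_measurable_SUP_int_index[of ?f M]] by simp
qed

lemma sets_mem_CI:
  assumes "n > 0" and "sets M = sets (Pi\<^sub>M {..<n} (\<lambda>_. borel))"
  shows "{X \<in> space M. \<theta> \<in> CI n \<alpha> X} \<in> sets M"
proof -
  note [measurable] = borel_measurable_CI_lower[OF assms] borel_measurable_CI_upper[OF assms]
  show ?thesis unfolding CI_def by simp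
qed

text \<open>The interval is the section at \<open>X\<close> of the jointly measurable set
  \<open>R\<close>, and the measure of sections is measurable by Tonelli's theorem.\<close>

lemma sets_length_CI_le:
  assumes "n > 0" and "sets M = sets (Pi\<^sub>M {..<n} (\<lambda>_. borel))"
  shows "{X \<in> space M. emeasure lborel (CI n \<alpha> X) \<le> c} \<in> sets M"
proof -
  note [measurable] = borel_measurable_CI_lower[OF assms] borel_measurable_CI_upper[OF assms]
  define R where "R = {p \<in> space (M \<Otimes>\<^sub>M lborel).
    CI_lower n \<alpha> (fst p) \<le> ereal (snd p) \<and> ereal (snd p) \<le> CI_upper n \<alpha> (fst p)}"
  have "R \<in> sets (M \<Otimes>\<^sub>M lborel)" unfolding R_def by measurable
  then have [measurable]: "(\<lambda>X. emeasure lborel (Pair X -` R)) \<in> borel_measurable M"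
    by (rule lborel.measurable_emeasure_Pair)
  have "{X \<in> space M. emeasure lborel (Pair X -` R) \<le> c} \<in> sets M" by measurable
  also have "{X \<in> space M. emeasure lborel (Pair X -` R) \<le> c} =
      {X \<in> space M. emeasure lborel (CI n \<alpha> X) \<le> c}"
    by (intro Collect_cong conj_cong refl)
       (auto simp: R_def CI_def vimage_def space_pair_measure)
  finally show ?thesis .
qed

section \<open>Hoeffding's inequality and the union bound\<close>

lemma prob_freq_deviation:
  assumes "real_distribution P" and A: "A \<in> sets borel" and "n > 0" "\<eta> \<ge> 0"
  defines "S \<equiv> Pi\<^sub>M {..<n} (\<lambda>_. P)"
  shows "measure S {X \<in> space S. freq n X A \<ge> measure P A + \<eta>} \<le> exp (- 2 * real n * \<eta>\<^sup>2)"
    and "measure S {X \<in> space S. freq n X A \<le> measure P A - \<eta>} \<le> exp (- 2 * real n * \<eta>\<^sup>2)"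
proof -
  interpret P: real_distribution P by fact
  interpret S: prob_space S unfolding S_def by (intro prob_space_PiM P.prob_space_axioms)
  have [measurable]: "A \<in> sets borel" by fact
  have [measurable_cong]: "sets S = sets (Pi\<^sub>M {..<n} (\<lambda>_. borel))"
    unfolding S_def by (intro sets_PiM_cong) auto
  have comp: "distr S P (\<lambda>X. X i) = P" if "i < n" for i
    unfolding S_def using that by (intro distr_PiM_component) (auto intro: P.prob_space_axioms)
  have dist: "distr S borel (\<lambda>X. indicator A (X i) :: real) = distr P borel (indicator A)" if "i < n" for i
  proof -
    have "distr S borel (\<lambda>X. indicator A (X i) :: real) =
        distr (distr S P (\<lambda>X. X i)) borel (indicator A)"
      using that by (subst distr_distr) (auto simp: comp_def S_def)
    then show ?thesis using comp[OF that] by simp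
  qed
  \<comment> \<open>Independence means that the joint law is the product of the marginals; here the
    joint map is the identity on \<open>S\<close>, a product measure by definition.\<close>
  have "S.indep_vars (\<lambda>_. P) (\<lambda>i X. X i) {..<n}"
  proof (subst S.indep_vars_iff_distr_eq_PiM')
    have "distr S (Pi\<^sub>M {..<n} (\<lambda>_. P)) (\<lambda>X. \<lambda>i\<in>{..<n}. X i) = distr S S (\<lambda>X. X)"
      by (rule distr_cong) (auto simp: S_def space_PiM PiE_def extensional_restrict)
    also have "\<dots> = S" by simp
    also have "S = Pi\<^sub>M {..<n} (\<lambda>i. distr S P (\<lambda>X. X i))"
      unfolding S_def by (rule PiM_cong) (use comp in \<open>auto simp: S_def\<close>)
    finally show "distr S (Pi\<^sub>M {..<n} (\<lambda>_. P)) (\<lambda>X. \<lambda>i\<in>{..<n}. X i) =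
        Pi\<^sub>M {..<n} (\<lambda>i. distr S P (\<lambda>X. X i))" .
  qed (use \<open>n > 0\<close> in \<open>auto simp: S_def\<close>)
  then have ind: "S.indep_vars (\<lambda>_. borel) (\<lambda>i X. indicator A (X i) :: real) {..<n}"
    by (rule S.indep_vars_compose2) auto
  have E: "S.expectation (\<lambda>X. indicator A (X 0) :: real) = measure P A"
  proof -
    have "S.expectation (\<lambda>X. indicator A (X 0) :: real) = integral\<^sup>L (distr S P (\<lambda>X. X 0)) (indicator A)"
      using \<open>n > 0\<close> by (subst integral_distr) (auto simp: S_def)
    then show ?thesis using comp[OF \<open>n > 0\<close>] by simp
  qed
  interpret H: Hoeffding_ineq_iid S "{..<n}" "\<lambda>i X. indicator A (X i)" "\<lambda>X. indicator A (X 0)" 0 1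
    "measure P A"
  proof unfold_locales
    show "S.indep_vars (\<lambda>_. borel) (\<lambda>i X. indicator A (X i) :: real) {..<n}" by (rule ind)
    show "distr S borel (\<lambda>X. indicator A (X i) :: real) = distr S borel (\<lambda>X. indicator A (X 0))"
      if "i \<in> {..<n}" for i
      using dist that \<open>n > 0\<close> by simp
    have "(\<lambda>X. X 0) \<in> measurable S P"
      unfolding S_def using \<open>n > 0\<close> by (intro measurable_component_singleton) simp
    then show "(\<lambda>X. indicator A (X 0) :: real) \<in> borel_measurable S"
      by (rule measurable_compose) simp
    show "measure P A \<equiv> S.expectation (\<lambda>X. indicator A (X 0))" using E by simp
  qed (auto split: split_indicator)
  show "measure S {X \<in> space S. freq n X A \<ge> measure P A + \<eta>} \<le> exp (- 2 * real n * \<eta>\<^sup>2)"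
    and "measure S {X \<in> space S. freq n X A \<le> measure P A - \<eta>} \<le> exp (- 2 * real n * \<eta>\<^sup>2)"
    using H.Hoeffding_ineq_ge'[of \<eta>] H.Hoeffding_ineq_le'[of \<eta>] assms by (auto simp: freq_def)
qed

lemma measure_contaminated_normal:
  assumes "real_distribution Q" "A \<in> sets borel" "0 \<le> \<epsilon>" "\<epsilon> \<le> 1"
  shows "measure (contaminated_normal \<epsilon> \<theta> Q) A =
    (1 - \<epsilon>) * measure (density lborel (normal_density \<theta> 1)) A + \<epsilon> * measure Q A"
proof -
  interpret Q: real_distribution Q by fact
  interpret N: prob_space "density lborel (normal_density \<theta> 1)"
    by (rule prob_space_normal_density) simp
  show ?thesis
    using assms
    by (simp add: measure_def[of "contaminated_normal \<epsilon> \<theta> Q"] emeasure_contaminated_normal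
        N.emeasure_eq_measure Q.emeasure_eq_measure flip: ennreal_mult ennreal_plus)
qed

lemma (in prob_space) prob_ge_if_bad_events:
  assumes "finite I" "\<And>i. i \<in> I \<Longrightarrow> B i \<in> events" "E \<in> events"
    and "space M - (\<Union>i\<in>I. B i) \<subseteq> E" "(\<Sum>i\<in>I. prob (B i)) \<le> a"
  shows "1 - a \<le> prob E"
proof -
  have "1 - a \<le> 1 - prob (\<Union>i\<in>I. B i)"
    using finite_measure_subadditive_finite[of I B] assms by (auto simp: image_subset_iff)
  also have "\<dots> = prob (space M - (\<Union>i\<in>I. B i))"
    using assms by (intro prob_compl[symmetric] sets.finite_UN) auto
  also have "\<dots> \<le> prob E" using assms by (intro finite_measure_mono) auto
  finally show ?thesis .
qed

section \<open>Samples from the contaminated model\<close>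

text \<open>The deviation at which Hoeffding's one-sided bound equals \<alpha>/2 (see
  \<open>exp_\<delta>\<close>), so that two such events cost \<alpha>.\<close>

definition radius :: "nat \<Rightarrow> real \<Rightarrow> real" where
  "radius n \<alpha> = sqrt (ln (2 / \<alpha>) / (2 * real n))"

text \<open>\<open>\<delta>_less_1\<close> puts \<open>1 - \<delta>\<close> strictly between 0 and
  1, so that \<open>t_max\<close> is a genuine Gaussian quantile.\<close>

locale contaminated_sample =
  fixes n :: nat and \<alpha> \<epsilon> \<theta> :: real and Q :: "real measure"
  assumes n: "n > 0" and \<alpha>: "0 < \<alpha>" "\<alpha> < 1" and \<epsilon>: "0 \<le> \<epsilon>" "\<epsilon> \<le> 0.05"
    and Q: "real_distribution Q" and \<delta>_less_1: "radius n \<alpha> < 1"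
begin

abbreviation \<delta> :: real where "\<delta> \<equiv> radius n \<alpha>"
abbreviation P :: "real measure" where "P \<equiv> contaminated_normal \<epsilon> \<theta> Q"
abbreviation S :: "(nat \<Rightarrow> real) measure" where "S \<equiv> sampling n \<epsilon> \<theta> Q"

sublocale P: real_distribution P
  using Q \<epsilon> by (intro real_distribution_contaminated_normal) auto

sublocale S: prob_space S
  unfolding sampling_def by (intro prob_space_PiM P.prob_space_axioms)

sublocale Q: real_distribution Q by (rule Q)

lemma sets_S: "sets S = sets (Pi\<^sub>M {..<n} (\<lambda>_. borel))"
  unfolding sampling_def by (intro sets_PiM_cong) auto

lemma \<delta>_pos: "\<delta> > 0"
  using n \<alpha> by (simp add: radius_def)

lemma Phi_t_max: "\<Phi> (t_max n \<alpha>) = 1 - \<delta>"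
  unfolding t_max_def radius_def[symmetric] using \<delta>_pos \<delta>_less_1 by (intro Phi_quantile_Phi) auto

lemma exp_\<delta>: "exp (- 2 * real n * \<delta>\<^sup>2) = \<alpha> / 2"
proof -
  have "ln (2 / \<alpha>) > 0" using \<alpha> by simp
  then have "- 2 * real n * \<delta>\<^sup>2 = ln (\<alpha> / 2)"
    using n \<alpha> by (simp add: radius_def ln_div)
  then show ?thesis using \<alpha> by simp
qed

lemma borel_measurable_freq [measurable]:
  assumes "A \<in> sets borel"
  shows "(\<lambda>X. freq n X A) \<in> borel_measurable S"
proof -
  note [measurable_cong] = sets_S and [measurable] = assms
  show ?thesis unfolding freq_def by measurable
qed

lemma freq_deviation:
  assumes "A \<in> sets borel" "\<eta> \<ge> 0"
  shows "S.prob {X \<in> space S. freq n X A \<ge> P.prob A + \<eta>} \<le> exp (- 2 * real n * \<eta>\<^sup>2)"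
    and "S.prob {X \<in> space S. freq n X A \<le> P.prob A - \<eta>} \<le> exp (- 2 * real n * \<eta>\<^sup>2)"
  using prob_freq_deviation[OF P.real_distribution_axioms assms(1) n assms(2)]
  by (simp_all add: sampling_def)

text \<open>Contamination only adds mass to the Gaussian part, whose weight is at least
  0.95.\<close>

lemma prob_P_lower:
  assumes "A \<in> sets borel" "measure (density lborel (normal_density \<theta> 1)) A = p"
  shows "0.95 * p \<le> P.prob A"
proof -
  have "p \<ge> 0" using assms(2) by auto
  then have "0.95 * p \<le> (1 - \<epsilon>) * p" using \<epsilon> by (intro mult_right_mono) auto
  then show ?thesis
    using assms \<epsilon> Q by (simp add: measure_contaminated_normal add_increasing2)
qed

text \<open>The worst case is a contamination lying entirely inside \<open>A\<close>.\<close>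

lemma prob_P_upper:
  assumes "A \<in> sets borel" "measure (density lborel (normal_density \<theta> 1)) A = p"
  shows "P.prob A \<le> p + \<epsilon>"
proof -
  have "p \<ge> 0" using assms(2) by auto
  then have "(1 - \<epsilon>) * p \<le> 1 * p" using \<epsilon> by (intro mult_right_mono) auto
  moreover have "\<epsilon> * Q.prob A \<le> \<epsilon> * 1" using \<epsilon> by (intro mult_left_mono) auto
  ultimately show ?thesis
    using assms \<epsilon> Q by (simp add: measure_contaminated_normal)
qed

section \<open>Coverage\<close>

text \<open>The deterministic core: the two constraints that a single \<open>t\<close> puts on
  \<theta> follow from two tail frequencies. Strictness in \<open>hi\<close> becomes, after
  complementation, the strict hypothesis of \<open>quantile_ecdf_ge\<close>.\<close>

lemma quantile_bounds_if_freq_large: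
  assumes lo: "freq n X {..\<theta> - t + 2 / t} \<ge> 2 * (1 - \<Phi> t)"
    and hi: "freq n X {\<theta> + t - 2 / t..} > 2 * (1 - \<Phi> t)"
  shows "quantile (ecdf n X) (2 * (1 - \<Phi> t)) + t - 2 / t \<le> \<theta>"
    and "\<theta> \<le> quantile (ecdf n X) (1 - 2 * (1 - \<Phi> t)) - t + 2 / t"
proof -
  show "quantile (ecdf n X) (2 * (1 - \<Phi> t)) + t - 2 / t \<le> \<theta>"
    using quantile_ecdf_le[of "2 * (1 - \<Phi> t)" n X "\<theta> - t + 2 / t"] lo Phi_less_1[of t]
    by (simp add: ecdf_eq_freq)
  have "- {\<theta> + t - 2 / t..} = {..<\<theta> + t - 2 / t}" by auto
  then have "freq n X {..<\<theta> + t - 2 / t} < 1 - 2 * (1 - \<Phi> t)"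
    using hi freq_compl[OF n, of X "{\<theta> + t - 2 / t..}"] by simp
  then have "\<theta> + t - 2 / t \<le> quantile (ecdf n X) (1 - 2 * (1 - \<Phi> t))"
    using n Phi_less_1[of t] by (intro quantile_ecdf_ge) auto
  then show "\<theta> \<le> quantile (ecdf n X) (1 - 2 * (1 - \<Phi> t)) - t + 2 / t" by simp
qed

lemma coverage: "S.prob {X \<in> space S. \<theta> \<in> CI n \<alpha> X} \<ge> 1 - \<alpha>"
proof (cases "t_max n \<alpha> < 1.6")
  case True
  then have "CI n \<alpha> X = UNIV" for X
    by (auto simp: CI_def CI_lower_def CI_upper_def bot_ereal_def top_ereal_def)
  then show ?thesis using \<alpha> by (simp add: S.prob_space)
next
  case False
  define s where "s k = \<delta> * (3 / 2) ^ k" for k :: nat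
  have s_pos: "s k > 0" for k using \<delta>_pos by (simp add: s_def)
  have s_Suc: "s (Suc k) = 3 / 2 * s k" for k by (simp add: s_def)
  obtain N where N: "1 < s N"
  proof -
    obtain N where "1 / \<delta> < (3 / 2) ^ N" using real_arch_pow[of "3 / 2" "1 / \<delta>"] by auto
    then show ?thesis using that[of N] \<delta>_pos by (simp add: s_def field_simps)
  qed
  \<comment> \<open>Only grid levels whose quantile is at least 1.6 are kept, since
    \<open>normal_tail_ratio\<close> needs this.\<close>
  define I where "I = {k\<in>{..<N}. s k \<le> 1 - \<Phi> 1.6}"
  have "\<exists>\<tau>. \<Phi> \<tau> = 1 - s k" if "k \<in> I" for k
    using that s_pos[of k] normal_tail_le_fifth[of "1.6"] ex_Phi_eq[of "1 - s k"] by (force simp: I_def)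
  then obtain \<tau> where \<tau>: "\<Phi> (\<tau> k) = 1 - s k" if "k \<in> I" for k by metis
  have \<tau>_ge: "\<tau> k \<ge> 1.6" if "k \<in> I" for k
  proof -
    have "\<Phi> 1.6 \<le> \<Phi> (\<tau> k)" using \<tau>[OF that] that by (simp add: I_def)
    then show ?thesis by simp
  qed
  define lo where "lo k = {..\<theta> - \<tau> k + 2 / \<tau> k}" for k
  define hi where "hi k = {\<theta> + \<tau> k - 2 / \<tau> k..}" for k
  \<comment> \<open>Off the bad event the frequency exceeds 19/4 - 3/2 = 13/4 times
    \<open>s k\<close>, while one grid cell requires at most 2 * 3/2 = 3 times
    \<open>s k\<close>.\<close>
  define bad where "bad A k = {X \<in> space S. freq n X A \<le> P.prob A - 3 / 2 * s k}" for A k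
  have P_ge: "P.prob (lo k) \<ge> 19 / 4 * s k" "P.prob (hi k) \<ge> 19 / 4 * s k" if "k \<in> I" for k
  proof -
    define p where "p = 1 - \<Phi> (\<tau> k - 2 / \<tau> k)"
    have "p \<ge> 5 * s k"
      using normal_tail_ratio[OF \<tau>_ge[OF that]] \<tau>[OF that] by (simp add: p_def)
    moreover have "0.95 * p \<le> P.prob (lo k)"
      using measure_normal_tails(3)[of \<theta> "\<tau> k - 2 / \<tau> k"]
      by (intro prob_P_lower) (auto simp: lo_def p_def algebra_simps)
    moreover have "0.95 * p \<le> P.prob (hi k)"
      using measure_normal_tails(1)[of \<theta> "\<tau> k - 2 / \<tau> k"]
      by (intro prob_P_lower) (auto simp: hi_def p_def algebra_simps)
    ultimately show "P.prob (lo k) \<ge> 19 / 4 * s k" "P.prob (hi k) \<ge> 19 / 4 * s k"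
      by (simp_all add: power2_eq_square)
  qed
  have bad_prob: "S.prob (bad A k) \<le> \<alpha> / 2 * (1 / 2) ^ Suc k" if "A \<in> sets borel" for A k
  proof -
    \<comment> \<open>The exponent is (9/4)^(k+1) times the one in \<open>exp_\<delta>\<close>,
      hence at least k + 2 times it, which gives the bound (\<alpha>/2)^(k+2). Bounding all but one
      factor by 1/2 then leaves a geometric series with total \<alpha>/2 per tail.\<close>
    have bern: "real (Suc k) + 1 \<le> (9 / 4) ^ Suc k"
    proof -
      have "real (Suc k) + 1 \<le> 1 + real (Suc k) * (5 / 4)" by simp
      also have "\<dots> \<le> (1 + 5 / 4) ^ Suc k" by (rule Bernoulli_inequality) simp
      finally show ?thesis by simp
    qed
    have "S.prob (bad A k) \<le> exp (- 2 * real n * (3 / 2 * s k)\<^sup>2)"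
      unfolding bad_def using that s_pos[of k] by (intro freq_deviation(2)) auto
    also have "(3 / 2 * s k)\<^sup>2 = \<delta>\<^sup>2 * (9 / 4) ^ Suc k"
      by (simp add: s_def power_mult_distrib power2_eq_square flip: power_mult_distrib)
    also have "exp (- 2 * real n * (\<delta>\<^sup>2 * (9 / 4) ^ Suc k)) \<le>
        exp (real (Suc (Suc k)) * (- 2 * real n * \<delta>\<^sup>2))"
      using mult_left_mono[OF bern, of "2 * real n * \<delta>\<^sup>2"] by (simp add: algebra_simps)
    also have "\<dots> = (\<alpha> / 2) ^ Suc (Suc k)"
      by (simp only: exp_of_nat_mult exp_\<delta>)
    also have "\<dots> = \<alpha> / 2 * (\<alpha> / 2) ^ Suc k" by simp
    also have "\<dots> \<le> \<alpha> / 2 * (1 / 2) ^ Suc k"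
      using \<alpha> by (intro mult_left_mono power_mono) auto
    finally show ?thesis .
  qed
  have bad_sets: "bad A k \<in> S.events" if "A \<in> sets borel" for A k
  proof -
    note [measurable] = borel_measurable_freq[OF that]
    show ?thesis unfolding bad_def by measurable
  qed
  show ?thesis
  proof (rule S.prob_ge_if_bad_events[where I = I and B = "\<lambda>k. bad (lo k) k \<union> bad (hi k) k"])
    show "finite I" by (simp add: I_def)
    show "bad (lo k) k \<union> bad (hi k) k \<in> S.events" for k
      by (intro sets.Un bad_sets) (auto simp: lo_def hi_def)
    show "{X \<in> space S. \<theta> \<in> CI n \<alpha> X} \<in> S.events" by (rule sets_mem_CI[OF n sets_S])
    have "(\<Sum>k\<in>I. S.prob (bad (lo k) k \<union> bad (hi k) k)) \<le> (\<Sum>k\<in>I. \<alpha> * (1 / 2) ^ Suc k)"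
    proof (rule sum_mono)
      fix k
      have "S.prob (bad (lo k) k \<union> bad (hi k) k) \<le> S.prob (bad (lo k) k) + S.prob (bad (hi k) k)"
        by (intro measure_Un_le bad_sets) (auto simp: lo_def hi_def)
      also have "\<dots> \<le> \<alpha> / 2 * (1 / 2) ^ Suc k + \<alpha> / 2 * (1 / 2) ^ Suc k"
        by (intro add_mono bad_prob) (auto simp: lo_def hi_def)
      finally show "S.prob (bad (lo k) k \<union> bad (hi k) k) \<le> \<alpha> * (1 / 2) ^ Suc k" by simp
    qed
    also have "\<dots> \<le> (\<Sum>k<N. \<alpha> * (1 / 2) ^ Suc k)"
      using \<alpha> by (intro sum_mono2) (auto simp: I_def)
    also have "\<dots> = \<alpha> * (1 - (1 / 2) ^ N)"
      by (induction N) (auto simp: algebra_simps)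
    also have "\<dots> \<le> \<alpha> * 1" using \<alpha> by (intro mult_left_mono) auto
    finally show "(\<Sum>k\<in>I. S.prob (bad (lo k) k \<union> bad (hi k) k)) \<le> \<alpha>" by simp
    show "space S - (\<Union>k\<in>I. bad (lo k) k \<union> bad (hi k) k) \<subseteq> {X \<in> space S. \<theta> \<in> CI n \<alpha> X}"
    proof
      fix X assume X: "X \<in> space S - (\<Union>k\<in>I. bad (lo k) k \<union> bad (hi k) k)"
      have "quantile (ecdf n X) (2 * (1 - \<Phi> t)) + t - 2 / t \<le> \<theta> \<and>
          \<theta> \<le> quantile (ecdf n X) (1 - 2 * (1 - \<Phi> t)) - t + 2 / t"
        if t: "1.6 \<le> t" "t \<le> t_max n \<alpha>" for t
      proof -
        have "\<Phi> t \<le> \<Phi> (t_max n \<alpha>)" using t by simp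
        then have \<delta>_le: "s 0 \<le> 1 - \<Phi> t" by (simp add: Phi_t_max s_def)
        have "\<Phi> 1.6 \<le> \<Phi> t" using t by simp
        then have tail: "1 - \<Phi> t \<le> 1 - \<Phi> 1.6" by simp
        have ltN: "1 - \<Phi> t < s N" using N normal_tail_le_fifth[OF t(1)] by linarith
        \<comment> \<open>The predecessor \<open>k\<close> of the first grid level above
          \<open>1 - \<Phi> t\<close> satisfies
          \<open>s k \<le> 1 - \<Phi> t < 3 / 2 * s k\<close>.\<close>
        define m where "m = (LEAST m. 1 - \<Phi> t < s m)"
        have m: "1 - \<Phi> t < s m" unfolding m_def by (rule LeastI[where P = "\<lambda>m. 1 - \<Phi> t < s m", OF ltN])
        then have "m \<noteq> 0" using \<delta>_le by (metis not_le)
        then obtain k where k: "m = Suc k" by (cases m) auto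
        have "\<not> 1 - \<Phi> t < s k" using k unfolding m_def by (intro not_less_Least) simp
        then have sk: "s k \<le> 1 - \<Phi> t" by simp
        have "m \<le> N" unfolding m_def by (rule Least_le[where P = "\<lambda>m. 1 - \<Phi> t < s m", OF ltN])
        then have I: "k \<in> I" using order_trans[OF sk tail] k by (simp add: I_def)
        have "\<Phi> t \<le> \<Phi> (\<tau> k)" using \<tau>[OF I] sk by simp
        then have "t \<le> \<tau> k" by simp
        \<comment> \<open>Since \<open>y - 2 / y\<close> increases, the tail events at
          \<open>t\<close> contain those at the grid point \<open>\<tau> k\<close>, where the
          frequencies are controlled.\<close>
        then have "t - 2 / t \<le> \<tau> k - 2 / \<tau> k"
          using t by (intro diff_mono divide_left_mono) auto
        then have sub: "lo k \<subseteq> {..\<theta> - t + 2 / t}" "hi k \<subseteq> {\<theta> + t - 2 / t..}"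
          by (auto simp: lo_def hi_def)
        have "freq n X A > 13 / 4 * s k" if "X \<notin> bad A k" "P.prob A \<ge> 19 / 4 * s k" for A
          using that X by (auto simp: bad_def)
        then have "freq n X (lo k) > 13 / 4 * s k" "freq n X (hi k) > 13 / 4 * s k"
          using X I P_ge[OF I] by auto
        then have "freq n X {..\<theta> - t + 2 / t} > 13 / 4 * s k" "freq n X {\<theta> + t - 2 / t..} > 13 / 4 * s k"
          using freq_mono[OF sub(1), of n X] freq_mono[OF sub(2), of n X] by linarith+
        moreover have "2 * (1 - \<Phi> t) < 13 / 4 * s k"
          using m s_pos[of k] unfolding k s_Suc by (simp add: field_simps)
        ultimately show ?thesis using quantile_bounds_if_freq_large[of t X] by auto
      qed
      then show "X \<in> {X \<in> space S. \<theta> \<in> CI n \<alpha> X}"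
        using X by (auto simp: CI_def CI_lower_def CI_upper_def intro!: SUP_least INF_greatest)
    qed
  qed
qed

section \<open>Length\<close>

text \<open>Hypothesis \<open>K\<close> says that the largest possible mass of either tail beyond
  \<theta> plus or minus \<open>K\<close>, plus the deviation, stays within the quantile level; so
  with high probability both quantiles lie within \<open>K\<close> of \<theta>. Keeping
  \<open>K\<close> apart from \<open>t\<close> serves both regimes: \<open>K = t\<close> in
  \<open>length_small\<close>, and a fixed \<open>K\<close> with \<open>t = 1.6\<close> in
  \<open>length_const\<close>.\<close>

lemma length_at:
  assumes t: "1.6 \<le> t" "t \<le> t_max n \<alpha>" and K: "\<epsilon> + (1 - \<Phi> K) + \<delta> \<le> 2 * (1 - \<Phi> t)"
    and c: "2 * K - 2 * t + 4 / t \<le> c"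
  shows "S.prob {X \<in> space S. emeasure lborel (CI n \<alpha> X) \<le> ennreal c} \<ge> 1 - \<alpha>"
proof -
  define bad where "bad A = {X \<in> space S. freq n X A \<ge> P.prob A + \<delta>}" for A
  define lo where "lo = {..<\<theta> - K}"
  define hi where "hi = {\<theta> + K<..}"
  have borel: "lo \<in> sets borel" "hi \<in> sets borel" by (auto simp: lo_def hi_def)
  have P_le: "P.prob lo + \<delta> \<le> 2 * (1 - \<Phi> t)" "P.prob hi + \<delta> \<le> 2 * (1 - \<Phi> t)"
    using prob_P_upper[of lo "1 - \<Phi> K"] prob_P_upper[of hi "1 - \<Phi> K"] measure_normal_tails(2,4) K
    by (auto simp: lo_def hi_def)
  have prob_bad: "S.prob (bad A) \<le> \<alpha> / 2" if "A \<in> sets borel" for A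
    unfolding bad_def exp_\<delta>[symmetric] using that \<delta>_pos by (intro freq_deviation) auto
  have bad_sets: "bad A \<in> S.events" if "A \<in> sets borel" for A
  proof -
    note [measurable] = borel_measurable_freq[OF that]
    show ?thesis unfolding bad_def by measurable
  qed
  show ?thesis
  proof (rule S.prob_ge_if_bad_events[where I = "{lo, hi}" and B = bad])
    show "(\<Sum>A\<in>{lo, hi}. S.prob (bad A)) \<le> \<alpha>"
      using prob_bad[OF borel(1)] prob_bad[OF borel(2)] \<alpha> by (cases "lo = hi") auto
    show "{X \<in> space S. emeasure lborel (CI n \<alpha> X) \<le> ennreal c} \<in> S.events"
      by (rule sets_length_CI_le[OF n sets_S])
    show "space S - (\<Union>A\<in>{lo, hi}. bad A) \<subseteq> {X \<in> space S. emeasure lborel (CI n \<alpha> X) \<le> ennreal c}"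
    proof
      fix X assume X: "X \<in> space S - (\<Union>A\<in>{lo, hi}. bad A)"
      have fr: "freq n X lo < 2 * (1 - \<Phi> t)" "freq n X hi < 2 * (1 - \<Phi> t)"
        using X P_le by (auto simp: bad_def)
      have t5: "0 < 1 - \<Phi> t" "1 - \<Phi> t \<le> 1 / 5"
        using Phi_less_1[of t] normal_tail_le_fifth[OF t(1)] by auto
      have l: "\<theta> - K \<le> quantile (ecdf n X) (2 * (1 - \<Phi> t))"
        using fr(1) t5 n by (intro quantile_ecdf_ge) (auto simp: lo_def)
      have "- hi = {..\<theta> + K}" by (auto simp: hi_def)
      then have u: "quantile (ecdf n X) (1 - 2 * (1 - \<Phi> t)) \<le> \<theta> + K"
        using fr(2) t5 freq_compl[OF n, of X hi] by (intro quantile_ecdf_le) (auto simp: ecdf_eq_freq)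
      have "CI n \<alpha> X \<subseteq> {\<theta> - K + t - 2 / t..\<theta> + K - t + 2 / t}"
      proof
        fix x assume x: "x \<in> CI n \<alpha> X"
        have "ereal (quantile (ecdf n X) (2 * (1 - \<Phi> t)) + t - 2 / t) \<le> CI_lower n \<alpha> X"
          unfolding CI_lower_def using t by (intro SUP_upper) auto
        also have "\<dots> \<le> ereal x" using x by (simp add: CI_def)
        finally have 1: "\<theta> - K + t - 2 / t \<le> x" using l by simp
        have "ereal x \<le> CI_upper n \<alpha> X" using x by (simp add: CI_def)
        also have "\<dots> \<le> ereal (quantile (ecdf n X) (1 - 2 * (1 - \<Phi> t)) - t + 2 / t)"
          unfolding CI_upper_def using t by (intro INF_lower) auto
        finally show "x \<in> {\<theta> - K + t - 2 / t..\<theta> + K - t + 2 / t}" using u 1 by simp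
      qed
      then have "emeasure lborel (CI n \<alpha> X) \<le> emeasure lborel {\<theta> - K + t - 2 / t..\<theta> + K - t + 2 / t}"
        by (intro emeasure_mono) auto
      \<comment> \<open>If the endpoints are reversed, the left side is 0, so no sign condition is
        needed.\<close>
      also have "\<dots> \<le> ennreal (2 * K - 2 * t + 4 / t)"
        by (auto simp: emeasure_lborel_Icc_eq intro!: ennreal_leI)
      also have "\<dots> \<le> ennreal c" using c by (rule ennreal_leI)
      finally show "X \<in> {X \<in> space S. emeasure lborel (CI n \<alpha> X) \<le> ennreal c}" using X by simp
    qed
  qed (auto intro!: bad_sets borel)
qed

text \<open>\<delta> is at most 1/5, so \<open>n\<close> is at least 12.5 times
  \<open>ln (2 / \<alpha>)\<close>, which itself exceeds 1/2. In particular \<open>ln n\<close> is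
  positive; at \<open>n = 1\<close> the division convention would make
  \<open>1 / sqrt (ln n)\<close> zero.\<close>

lemma t_max_ge_imp_n_ge:
  assumes T: "1.6 \<le> t_max n \<alpha>"
  shows "real n \<ge> 6" "\<delta> \<le> 1 - \<Phi> 1.6"
proof -
  have "\<Phi> 1.6 \<le> \<Phi> (t_max n \<alpha>)" using T by simp
  then show \<delta>: "\<delta> \<le> 1 - \<Phi> 1.6" by (simp add: Phi_t_max)
  have "\<delta> \<le> 1 / 5" using \<delta> normal_tail_le_fifth[of "1.6"] by simp
  then have "\<delta>\<^sup>2 \<le> (1 / 5)\<^sup>2" using \<delta>_pos by (intro power_mono) auto
  moreover have L: "ln (2 / \<alpha>) \<ge> 1 / 2"
  proof -
    have "ln 2 \<le> ln (2 / \<alpha>)" using \<alpha> by (simp add: field_simps)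
    then show ?thesis using ln2_ge_two_thirds by linarith
  qed
  moreover have "\<delta>\<^sup>2 = ln (2 / \<alpha>) / (2 * real n)" using L by (simp add: radius_def)
  ultimately have "ln (2 / \<alpha>) / (2 * real n) \<le> 1 / 25" by (simp only:) (simp add: power2_eq_square)
  then have "25 * ln (2 / \<alpha>) \<le> 2 * real n" using n by (simp add: field_simps)
  then show "real n \<ge> 6" using L by linarith
qed

text \<open>The budget \<open>2 * (1 - \<Phi> 1.6)\<close> splits into one tail for \<delta> and
  another, at least 0.052, for \<epsilon> and the mass beyond \<open>K\<close>. At
  \<open>t = 1.6\<close> the length is below \<open>2 * K\<close> because 4/1.6 < 3.2.\<close>

lemma length_const:
  assumes T: "1.6 \<le> t_max n \<alpha>" and K: "1 - \<Phi> K \<le> 0.002" and c: "2 * K \<le> c"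
  shows "S.prob {X \<in> space S. emeasure lborel (CI n \<alpha> X) \<le> ennreal c} \<ge> 1 - \<alpha>"
proof (rule length_at)
  show "\<epsilon> + (1 - \<Phi> K) + \<delta> \<le> 2 * (1 - \<Phi> 1.6)"
    using \<epsilon> K t_max_ge_imp_n_ge[OF T] normal_tail_1_6 by simp
qed (use T c in auto)

text \<open>The first bound on \<open>n\<close> gives \<delta> \<le> 0.025, so that \<open>t\<close>
  is at least 1.6; the second gives \<open>s ^ 4 \<le> 1 / n\<close> when \<delta> dominates, hence
  \<open>ln n \<le> 4 * ln (1 / s)\<close>.\<close>

lemma length_small:
  assumes T: "1.6 \<le> t_max n \<alpha>" and \<epsilon>_small: "\<epsilon> \<le> 0.025"
    and n_large: "real n \<ge> 800 * ln (2 / \<alpha>)" "real n \<ge> 4 * (ln (2 / \<alpha>))\<^sup>2"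
  shows "S.prob {X \<in> space S. emeasure lborel (CI n \<alpha> X) \<le>
    ennreal (12 * (1 / sqrt (ln (real n)) + inv_sqrt_log_inv \<epsilon>))} \<ge> 1 - \<alpha>"
proof -
  define L where "L = ln (2 / \<alpha>)"
  have L: "L > 0" using \<alpha> by (simp add: L_def)
  have \<delta>2: "\<delta>\<^sup>2 = L / (2 * real n)" using L by (simp add: radius_def L_def)
  have n6: "real n \<ge> 6" using t_max_ge_imp_n_ge[OF T] by simp
  \<comment> \<open>Since \<epsilon> + \<delta> \<le> s, the choice \<open>1 - \<Phi> t = s\<close>
    meets the condition of \<open>length_at\<close> with \<open>K = t\<close>.\<close>
  define s where "s = 2 * max \<delta> \<epsilon>"
  have s: "s \<ge> 2 * \<delta>" "s \<ge> 2 * \<epsilon>" "s > 0" using \<delta>_pos by (auto simp: s_def)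
  have "L / (2 * real n) \<le> 0.025\<^sup>2"
    using n_large n by (simp add: L_def[symmetric] field_simps power2_eq_square)
  then have "\<delta>\<^sup>2 \<le> 0.025\<^sup>2" by (simp only: \<delta>2)
  then have "\<delta> \<le> 0.025" by (rule power2_le_imp_le) simp
  then have s5: "s \<le> 0.05" using \<epsilon>_small by (simp add: s_def)
  then obtain t where t: "\<Phi> t = 1 - s" using ex_Phi_eq[of "1 - s"] s by auto
  have "\<Phi> 1.6 \<le> \<Phi> t" using t s5 normal_tail_1_6 by simp
  then have t16: "1.6 \<le> t" by simp
  have "\<Phi> t \<le> \<Phi> (t_max n \<alpha>)" using t s \<delta>_pos by (simp add: Phi_t_max)
  then have tT: "t \<le> t_max n \<alpha>" by simp
  have n_pos: "1 / sqrt (ln (real n)) \<ge> 0" using n6 by simp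
  have \<epsilon>_pos: "inv_sqrt_log_inv \<epsilon> \<ge> 0" using \<epsilon> by (simp add: inv_sqrt_log_inv_def)
  have "4 / t \<le> 12 * (1 / sqrt (ln (real n)) + inv_sqrt_log_inv \<epsilon>)"
  proof (cases "\<delta> \<ge> \<epsilon>")
    case True
    then have "s\<^sup>2 = 4 * \<delta>\<^sup>2" by (simp add: s_def power2_eq_square)
    also have "\<dots> = 2 * L / real n" by (simp add: \<delta>2)
    finally have s2: "s\<^sup>2 = 2 * L / real n" .
    have "s ^ 4 = (s\<^sup>2)\<^sup>2" by (simp flip: power_mult)
    also have "\<dots> = (2 * L / real n)\<^sup>2" by (simp only: s2)
    also have "\<dots> = 4 * L\<^sup>2 / (real n * real n)" by (simp add: power2_eq_square)
    also have "\<dots> \<le> real n / (real n * real n)"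
      using n_large(2) by (intro divide_right_mono) (auto simp: L_def)
    also have "\<dots> = 1 / real n" by simp
    finally have "real n \<le> (1 / s) ^ 4"
      using s n by (simp add: field_simps)
    then have "ln (real n) \<le> ln ((1 / s) ^ 4)" using n s by (subst ln_le_cancel_iff) auto
    also have "\<dots> = 4 * ln (1 / s)" using s by (subst ln_realpow) auto
    finally have "4 / t \<le> 12 / sqrt (ln (real n))"
      using t n6 by (intro inverse_le_of_normal_tail[OF t16, of s]) auto
    then show ?thesis using \<epsilon>_pos by simp
  next
    case False
    then have \<epsilon>0: "\<epsilon> > 0" "s = 2 * \<epsilon>" using \<delta>_pos by (auto simp: s_def)
    \<comment> \<open>This makes \<open>s\<^sup>2\<close>, which is four times the square of
      \<epsilon>, at most \<epsilon>, so that
      \<open>ln (1 / \<epsilon>) \<le> 2 * ln (1 / s)\<close>.\<close>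
    have "\<epsilon> \<le> 1 / 4" using \<epsilon>_small by simp
    then have "\<epsilon> * \<epsilon> \<le> \<epsilon> * (1 / 4)" using \<epsilon>0 by (intro mult_left_mono) auto
    then have "1 / \<epsilon> \<le> (1 / s)\<^sup>2" using \<epsilon>0 by (simp add: field_simps power2_eq_square)
    then have "ln (1 / \<epsilon>) \<le> ln ((1 / s)\<^sup>2)" using \<epsilon>0 by (subst ln_le_cancel_iff) auto
    also have "\<dots> = 2 * ln (1 / s)" using s by (subst ln_realpow) auto
    also have "\<dots> \<le> 4 * ln (1 / s)"
    proof -
      have "ln (1 / s) \<ge> 0" using s s5 by simp
      then show ?thesis by simp
    qed
    finally have "4 / t \<le> 12 / sqrt (ln (1 / \<epsilon>))"
      using t \<epsilon>0 \<epsilon>_small by (intro inverse_le_of_normal_tail[OF t16, of s]) auto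
    then show ?thesis using n_pos \<epsilon>0 by (simp add: inv_sqrt_log_inv_def add_increasing)
  qed
  then show ?thesis
    using t s by (intro length_at[OF t16 tT, of t]) auto
qed

end

section \<open>Choice of the constants\<close>

text \<open>For \<alpha> \<le> 1/2, \<open>ln (2 / \<alpha>) \<le> 2 * ln (1 / \<alpha>)\<close>, so
  the squared radius is at most 1/400, which is the square of 0.05. For larger \<alpha>,
  \<open>ln (2 / \<alpha>) < 2\<close> and \<open>n \<ge> 1\<close> still keep the radius below
  1.\<close>

lemma radius_bounds:
  assumes \<alpha>: "0 < \<alpha>" "\<alpha> < 1" and n: "real n \<ge> 400 * ln (1 / \<alpha>)"
  shows "n > 0" "radius n \<alpha> < 1"
    and "\<alpha> \<le> 1 / 2 \<Longrightarrow> radius n \<alpha> \<le> 0.05"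
proof -
  have "ln (1 / \<alpha>) > 0" using \<alpha> by simp
  then show n0: "n > 0" using n by (auto intro: gr0I)
  have L: "ln (2 / \<alpha>) = ln 2 + ln (1 / \<alpha>)" using \<alpha> by (simp add: ln_div)
  show small: "radius n \<alpha> \<le> 0.05" if "\<alpha> \<le> 1 / 2"
  proof -
    have "ln 2 \<le> ln (1 / \<alpha>)" using \<alpha> that by (simp add: field_simps)
    then have "ln (2 / \<alpha>) / (2 * real n) \<le> 0.05\<^sup>2"
      using n n0 by (simp add: L field_simps power2_eq_square)
    then show ?thesis unfolding radius_def by (intro real_le_lsqrt) auto
  qed
  show "radius n \<alpha> < 1"
  proof (cases "\<alpha> \<le> 1 / 2")
    case True
    then show ?thesis by (intro le_less_trans[OF small]) auto
  next
    case False
    then have "ln (1 / \<alpha>) \<le> ln 2" using \<alpha> by (simp add: field_simps)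
    then have "ln (2 / \<alpha>) < 2" using L ln_2_less_1 by linarith
    then show ?thesis using n0 by (simp add: radius_def field_simps)
  qed
qed

lemma INF_contamination_ge:
  fixes f :: "real \<Rightarrow> real \<Rightarrow> real measure \<Rightarrow> real"
  assumes "\<And>\<epsilon> \<theta> Q. \<epsilon> \<in> {0..0.05} \<Longrightarrow> real_distribution Q \<Longrightarrow> a \<le> f \<epsilon> \<theta> Q"
  shows "a \<le> (INF (\<epsilon>, \<theta>, Q) \<in> {0..0.05} \<times> UNIV \<times> {Q. real_distribution Q}. f \<epsilon> \<theta> Q)"
proof (rule cINF_greatest)
  \<comment> \<open>A real infimum is bounded below by its terms' common bound only over a nonempty
    index set.\<close>
  have "(0, 0, std_normal_distribution) \<in> {0..0.05::real} \<times> (UNIV :: real set) \<times> {Q. real_distribution Q}"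
    using real_dist_normal_dist by simp
  then show "{0..0.05::real} \<times> (UNIV :: real set) \<times> {Q. real_distribution Q} \<noteq> {}" by blast
  show "a \<le> (case x of (\<epsilon>, \<theta>, Q) \<Rightarrow> f \<epsilon> \<theta> Q)"
    if "x \<in> {0..0.05} \<times> UNIV \<times> {Q. real_distribution Q}" for x
    using that assms by (cases x) simp
qed

text \<open>The guard on the length claim excludes a degenerate case: whatever \<open>C\<close> is,
  \<open>n = 1\<close> is admissible for \<alpha> close enough to 1, and then \<open>t_max\<close>
  is below 1.6 and the interval is the whole line. For \<alpha> \<le> 1/2 the sample size condition
  rules this out.\<close>

theorem theorem2:
  shows "\<exists>C::real. C > 0 \<and> (\<forall>\<alpha>::real. 0 < \<alpha> \<and> \<alpha> < 1 \<longrightarrow>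
    (\<exists>C'::real. C' > 0 \<and> (\<forall>n::nat. real n \<ge> C * ln (1 / \<alpha>) \<longrightarrow>
      (INF (\<epsilon>, \<theta>, Q) \<in> {0..0.05} \<times> UNIV \<times> {Q. real_distribution Q}.
         \<P>(X in sampling n \<epsilon> \<theta> Q. \<theta> \<in> CI n \<alpha> X)) \<ge> 1 - \<alpha> \<and>
      (\<alpha> \<le> 1 / 2 \<or> 1.6 \<le> t_max n \<alpha> \<longrightarrow>
        (INF (\<epsilon>, \<theta>, Q) \<in> {0..0.05} \<times> UNIV \<times> {Q. real_distribution Q}.
           \<P>(X in sampling n \<epsilon> \<theta> Q.
              emeasure lborel (CI n \<alpha> X)
                \<le> ennreal (C' * (1 / sqrt (ln (real n)) + inv_sqrt_log_inv \<epsilon>)))) \<ge> 1 - \<alpha>))))"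
proof -
  obtain K where K: "1 - \<Phi> K \<le> 0.002" "K \<ge> 1"
  proof -
    have "\<forall>\<^sub>F x in at_top. 0.998 < \<Phi> x" by (rule order_tendstoD(1)[OF Phi_tendsto_1]) simp
    then have "\<forall>\<^sub>F x in at_top. 0.998 < \<Phi> x \<and> x \<ge> 1"
      using eventually_ge_at_top[of 1] by eventually_elim simp
    then obtain x where "0.998 < \<Phi> x" "x \<ge> 1"
      using eventually_happens'[OF trivial_limit_at_top_linorder] by blast
    then show ?thesis by (intro that[of x]) auto
  qed
  have "\<exists>C'>0. \<forall>n::nat. real n \<ge> 400 * ln (1 / \<alpha>) \<longrightarrow>
      (INF (\<epsilon>, \<theta>, Q) \<in> {0..0.05} \<times> UNIV \<times> {Q. real_distribution Q}.
         \<P>(X in sampling n \<epsilon> \<theta> Q. \<theta> \<in> CI n \<alpha> X)) \<ge> 1 - \<alpha> \<and>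
      (\<alpha> \<le> 1 / 2 \<or> 1.6 \<le> t_max n \<alpha> \<longrightarrow>
        (INF (\<epsilon>, \<theta>, Q) \<in> {0..0.05} \<times> UNIV \<times> {Q. real_distribution Q}.
           \<P>(X in sampling n \<epsilon> \<theta> Q.
              emeasure lborel (CI n \<alpha> X)
                \<le> ennreal (C' * (1 / sqrt (ln (real n)) + inv_sqrt_log_inv \<epsilon>)))) \<ge> 1 - \<alpha>)"
    if \<alpha>: "0 < \<alpha>" "\<alpha> < 1" for \<alpha> :: real
  proof -
    define N where "N = max (800 * ln (2 / \<alpha>)) (4 * (ln (2 / \<alpha>))\<^sup>2)"
    \<comment> \<open>12 comes from \<open>length_small\<close>. The other two entries make
      \<open>C'\<close> times the rate at least \<open>2 * K\<close>, the bound of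
      \<open>length_const\<close>, when \<epsilon> > 0.025 = 1/40 or \<open>n < N\<close>.\<close>
    define C' where "C' = max 12 (max (2 * K * sqrt (ln 40)) (2 * K * sqrt (ln N)))"
    have C': "C' \<ge> 12" "C' \<ge> 2 * K * sqrt (ln 40)" "C' \<ge> 2 * K * sqrt (ln N)"
      by (auto simp: C'_def)
    show ?thesis
    proof (rule exI[of _ C'], intro conjI allI impI)
      show "C' > 0" using C' by simp
    next
      fix n :: nat assume n: "real n \<ge> 400 * ln (1 / \<alpha>)"
      note b = radius_bounds[OF \<alpha> n]
      have sample: "contaminated_sample n \<alpha> \<epsilon> Q" if "\<epsilon> \<in> {0..0.05}" "real_distribution Q" for \<epsilon> Q
        by (rule contaminated_sample.intro) (use that \<alpha> b(1,2) in auto)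
      show "(INF (\<epsilon>, \<theta>, Q) \<in> {0..0.05} \<times> UNIV \<times> {Q. real_distribution Q}.
         \<P>(X in sampling n \<epsilon> \<theta> Q. \<theta> \<in> CI n \<alpha> X)) \<ge> 1 - \<alpha>"
        by (rule INF_contamination_ge, rule contaminated_sample.coverage[OF sample])
      assume "\<alpha> \<le> 1 / 2 \<or> 1.6 \<le> t_max n \<alpha>"
      \<comment> \<open>Here \<delta> \<le> 0.05 < 0.052 \<le>
        \<open>1 - \<Phi> 1.6\<close>.\<close>
      moreover have "1.6 \<le> t_max n \<alpha>" if "\<alpha> \<le> 1 / 2"
      proof -
        have "\<Phi> (t_max n \<alpha>) = 1 - radius n \<alpha>"
          by (rule contaminated_sample.Phi_t_max[OF sample[of 0 std_normal_distribution]])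
             (auto intro: real_dist_normal_dist)
        then have "\<Phi> 1.6 \<le> \<Phi> (t_max n \<alpha>)" using b(3)[OF that] normal_tail_1_6 by simp
        then show ?thesis by simp
      qed
      ultimately have T: "1.6 \<le> t_max n \<alpha>" by blast
      have "\<P>(X in sampling n \<epsilon> \<theta> Q. emeasure lborel (CI n \<alpha> X)
          \<le> ennreal (C' * (1 / sqrt (ln (real n)) + inv_sqrt_log_inv \<epsilon>))) \<ge> 1 - \<alpha>"
        if \<epsilon>: "\<epsilon> \<in> {0..0.05}" and Q: "real_distribution Q" for \<epsilon> \<theta> Q
      proof -
        interpret contaminated_sample n \<alpha> \<epsilon> \<theta> Q
          by (rule sample[OF \<epsilon> Q])
        have n6: "real n \<ge> 6" using t_max_ge_imp_n_ge(1)[OF T] .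
        have n_pos: "1 / sqrt (ln (real n)) \<ge> 0" using n6 by simp
        have \<epsilon>_pos: "inv_sqrt_log_inv \<epsilon> \<ge> 0" using \<epsilon> by (simp add: inv_sqrt_log_inv_def)
        show ?thesis
        proof (cases "\<epsilon> \<le> 0.025 \<and> real n \<ge> N")
          case True
          then have "1 - \<alpha> \<le> S.prob {X \<in> space S. emeasure lborel (CI n \<alpha> X) \<le>
              ennreal (12 * (1 / sqrt (ln (real n)) + inv_sqrt_log_inv \<epsilon>))}"
            by (intro length_small[OF T]) (auto simp: N_def)
          also have "\<dots> \<le> S.prob {X \<in> space S. emeasure lborel (CI n \<alpha> X) \<le>
              ennreal (C' * (1 / sqrt (ln (real n)) + inv_sqrt_log_inv \<epsilon>))}"
          proof (rule S.finite_measure_mono)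
            have "ennreal (12 * (1 / sqrt (ln (real n)) + inv_sqrt_log_inv \<epsilon>)) \<le>
                ennreal (C' * (1 / sqrt (ln (real n)) + inv_sqrt_log_inv \<epsilon>))" (is "?c \<le> ?c'")
              using C' n_pos \<epsilon>_pos by (intro ennreal_leI mult_right_mono) auto
            then show "{X \<in> space S. emeasure lborel (CI n \<alpha> X) \<le> ?c} \<subseteq>
                {X \<in> space S. emeasure lborel (CI n \<alpha> X) \<le> ?c'}"
              using order_trans[of _ ?c ?c'] by blast
          qed (rule sets_length_CI_le[OF b(1) sets_S])
          finally show ?thesis .
        next
          case False
          have scale: "2 * K \<le> C' / sqrt x" if "0 < x" "x \<le> y" "2 * K * sqrt y \<le> C'" for x y
          proof -
            have "2 * K * sqrt x \<le> 2 * K * sqrt y" using that K by (intro mult_left_mono) auto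
            then show ?thesis using that by (simp add: field_simps)
          qed
          have "2 * K \<le> C' * (1 / sqrt (ln (real n)) + inv_sqrt_log_inv \<epsilon>)"
          proof (cases "\<epsilon> \<le> 0.025")
            case True
            with False have "real n < N" by simp
            then have "2 * K \<le> C' / sqrt (ln (real n))"
              using n6 C' by (intro scale[of _ "ln N"]) auto
            moreover have "0 \<le> C' * inv_sqrt_log_inv \<epsilon>" using C' \<epsilon>_pos by simp
            ultimately show ?thesis by (simp add: algebra_simps)
          next
            case eps: False
            have "2 * K \<le> C' / sqrt (ln (1 / \<epsilon>))"
              using eps \<epsilon> C' by (intro scale[of _ "ln 40"]) (auto simp: field_simps)
            moreover have "0 \<le> C' * (1 / sqrt (ln (real n)))" using C' n_pos by simp
            ultimately show ?thesis using eps by (simp add: inv_sqrt_log_inv_def algebra_simps)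
          qed
          then show ?thesis by (rule length_const[OF T K(1)])
        qed
      qed
      then show "(INF (\<epsilon>, \<theta>, Q) \<in> {0..0.05} \<times> UNIV \<times> {Q. real_distribution Q}.
           \<P>(X in sampling n \<epsilon> \<theta> Q.
              emeasure lborel (CI n \<alpha> X)
                \<le> ennreal (C' * (1 / sqrt (ln (real n)) + inv_sqrt_log_inv \<epsilon>)))) \<ge> 1 - \<alpha>"
        by (rule INF_contamination_ge)
    qed
  qed
  then show ?thesis by (intro exI[of _ "400::real"] conjI) (simp, blast)
qed

end
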